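(* Let $p$ be a prime and let $k$ be a field of characteristic $p$. Let $a>b>c$ be positive integers with $\gcd(a,b,c)=1$, and suppose that none of $a,\ b,\ c,\ a-c,\ a-b,\ b-c$ is divisible by $p$. Then $$k(N_a,N_b,N_c)=S,$$ i.e. the Newton polynomials $N_a,N_b,N_c$ generate over $k$ the whole field of symmetric rational functions in $x,y$.
   Context: $F=k(x,y)$ is the field of rational functions in two algebraically independent transcendentals $x,y$ over $k$, and $S\subset F$ is the subfield of symmetric functions, i.e. the elements of $F$ fixed by the $k$-automorphism exchanging $x$ and $y$. For $m\ge 1$, $N_m=x^m+y^m$. $k(N_a,N_b,N_c)$ is the subfield of $F$ generated over $k$ by $N_a,N_b,N_c$. *)

theory Defs
  imports "HOL-Computational_Algebra.Computational_Algebra"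
begin

section \<open>The field of rational functions in two variables\<close>

text \<open>
  The field \<open>F = k(x, y)\<close> is the fraction field of \<open>k[x][y]\<close>: the inner polynomial
  variable is \<open>x\<close> and the outer one is \<open>y\<close>.
\<close>

type_synonym 'k ratfun2 = "'k poly poly fract"

definition ratfun_const :: "'k::field \<Rightarrow> 'k ratfun2" where
  "ratfun_const c = to_fract [:[:c:]:]"

definition ratfun_X :: "'k::field ratfun2" where
  "ratfun_X = to_fract [:[:0, 1:]:]"

definition ratfun_Y :: "'k::field ratfun2" where
  "ratfun_Y = to_fract [:0, 1:]"

definition newton_poly :: "nat \<Rightarrow> 'k::field ratfun2" where
  "newton_poly m = ratfun_X ^ m + ratfun_Y ^ m"


section \<open>Generated subfields\<close>

definition is_subfield :: "'f::field set \<Rightarrow> bool" where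
  "is_subfield K \<longleftrightarrow> 0 \<in> K \<and> 1 \<in> K \<and>
     (\<forall>u\<in>K. \<forall>v\<in>K. u + v \<in> K \<and> u * v \<in> K) \<and>
     (\<forall>u\<in>K. - u \<in> K \<and> inverse u \<in> K)"

definition generated_field :: "'k::field ratfun2 set \<Rightarrow> 'k ratfun2 set" where
  "generated_field A = is_subfield hull (range ratfun_const \<union> A)"

lemma is_subfield_generated_field: "is_subfield (generated_field A)"
  unfolding generated_field_def by (rule hull_in) (auto simp: is_subfield_def)


section \<open>Symmetric rational functions\<close>

definition ratfun_automorphism :: "('k::field ratfun2 \<Rightarrow> 'k ratfun2) \<Rightarrow> bool" where
  "ratfun_automorphism \<sigma> \<longleftrightarrow> bij \<sigma> \<and>
     (\<forall>f g. \<sigma> (f + g) = \<sigma> f + \<sigma> g) \<and>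
     (\<forall>f g. \<sigma> (f * g) = \<sigma> f * \<sigma> g) \<and>
     (\<forall>c. \<sigma> (ratfun_const c) = ratfun_const c)"

text \<open>Existence and uniqueness are established in \<open>ex1_swap\<close> below.\<close>

definition ratfun_swap :: "'k::field ratfun2 \<Rightarrow> 'k ratfun2" where
  "ratfun_swap =
     (THE \<sigma>. ratfun_automorphism \<sigma> \<and> \<sigma> ratfun_X = ratfun_Y \<and> \<sigma> ratfun_Y = ratfun_X)"

definition symmetric_ratfuns :: "'k::field ratfun2 set" where
  "symmetric_ratfuns = {f. ratfun_swap f = f}"


subsection \<open>Existence and uniqueness of the exchanging automorphism\<close>

context
  fixes h :: "'a::comm_ring_1 \<Rightarrow> 'b::comm_ring_1" and v :: 'b
  assumes h0: "h 0 = 0" and hadd: "\<And>a b. h (a + b) = h a + h b"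
    and hmult: "\<And>a b. h (a * b) = h a * h b"
begin

private lemma eval_add:
  "poly (map_poly h (p + q)) v = poly (map_poly h p) v + poly (map_poly h q) v"
proof -
  have "map_poly h (p + q) = map_poly h p + map_poly h q"
    by (rule poly_eqI) (simp add: coeff_map_poly h0 hadd)
  then show ?thesis by simp
qed

private lemma eval_mult:
  "poly (map_poly h (p * q)) v = poly (map_poly h p) v * poly (map_poly h q) v"
proof (induction p)
  case (pCons a p)
  then show ?case
    by (simp add: mult_pCons_left eval_add map_poly_smult map_poly_pCons h0 hmult algebra_simps)
qed simp

lemmas eval_hom = eval_add eval_mult

end

definition poly_swap :: "'k::field poly poly \<Rightarrow> 'k poly poly" where
  "poly_swap P = poly (map_poly (map_poly (\<lambda>a. [:a:])) P) [:[:0, 1:]:]"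

lemma lift_hom:
  fixes p q :: "'k::field poly"
  shows "map_poly (\<lambda>a. [:a:]) (p + q) = map_poly (\<lambda>a. [:a:]) p + map_poly (\<lambda>a. [:a:]) q"
    and "map_poly (\<lambda>a. [:a:]) (p * q) = map_poly (\<lambda>a. [:a:]) p * map_poly (\<lambda>a. [:a:]) q"
proof -
  show add: "map_poly (\<lambda>a. [:a:]) (p + q) = map_poly (\<lambda>a. [:a:]) p + map_poly (\<lambda>a. [:a:]) q"
    for p q :: "'k poly"
    by (rule poly_eqI) (simp add: coeff_map_poly)
  show "map_poly (\<lambda>a. [:a:]) (p * q) = map_poly (\<lambda>a. [:a:]) p * map_poly (\<lambda>a. [:a:]) q"
  proof (induction p)
    case (pCons a p)
    have "map_poly (\<lambda>a. [:a:]) (smult a q) = smult [:a:] (map_poly (\<lambda>a. [:a:]) q)"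
      by (rule map_poly_smult) simp_all
    with pCons show ?case
      by (simp add: mult_pCons_left add map_poly_pCons)
  qed simp
qed

lemma poly_swap_add: "poly_swap (P + Q) = poly_swap P + poly_swap Q"
  unfolding poly_swap_def by (rule eval_hom) (simp_all add: lift_hom)

lemma poly_swap_mult: "poly_swap (P * Q) = poly_swap P * poly_swap Q"
  unfolding poly_swap_def by (rule eval_hom) (simp_all add: lift_hom)

lemma coeff_poly_swap: "coeff (coeff (poly_swap P) i) j = coeff (coeff P j) i"
proof (induction P arbitrary: j)
  case 0
  then show ?case by (simp add: poly_swap_def)
next
  case (pCons c P)
  have "poly_swap (pCons c P) = map_poly (\<lambda>a. [:a:]) c + smult [:0, 1:] (poly_swap P)"
    by (simp add: poly_swap_def map_poly_pCons)
  then show ?case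
    by (cases j) (simp_all add: coeff_map_poly pCons.IH)
qed

lemma poly_swap_poly_swap [simp]: "poly_swap (poly_swap P) = P"
  by (intro poly_eqI) (simp add: coeff_poly_swap)

lemma poly_swap_0 [simp]: "poly_swap 0 = 0"
  by (simp add: poly_swap_def)

lemma poly_swap_eq_0_iff [simp]: "poly_swap P = 0 \<longleftrightarrow> P = 0"
  by (metis poly_swap_0 poly_swap_poly_swap)

lemma poly_swap_simps [simp]:
  "poly_swap 1 = 1" "poly_swap [:[:c:]:] = [:[:c:]:]"
  "poly_swap [:[:0, 1:]:] = [:0, 1:]" "poly_swap [:0, 1:] = [:[:0, 1:]:]"
  by (simp_all add: poly_swap_def map_poly_pCons one_pCons)

lemma ex_swap:
  "\<exists>\<sigma> :: 'k::field ratfun2 \<Rightarrow> 'k ratfun2.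
     ratfun_automorphism \<sigma> \<and> \<sigma> ratfun_X = ratfun_Y \<and> \<sigma> ratfun_Y = ratfun_X"
proof -
  have "\<exists>r. \<forall>a b. b \<noteq> 0 \<longrightarrow> q = Fract a b \<longrightarrow> r = Fract (poly_swap a) (poly_swap b)"
    for q :: "'k ratfun2"
  proof -
    obtain a b where ab: "q = Fract a b" "b \<noteq> 0"
      by (cases q) auto
    have "Fract (poly_swap a) (poly_swap b) = Fract (poly_swap c) (poly_swap d)"
      if "d \<noteq> 0" "q = Fract c d" for c d
    proof -
      have "a * d = c * b"
        using that ab by (simp add: eq_fract)
      then have "poly_swap a * poly_swap d = poly_swap c * poly_swap b"
        by (metis poly_swap_mult)
      then show ?thesis
        using that ab by (simp add: eq_fract)
    qed
    then show ?thesis by blast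
  qed
  then obtain \<sigma> :: "'k ratfun2 \<Rightarrow> 'k ratfun2"
    where "\<And>q a b. b \<noteq> 0 \<Longrightarrow> q = Fract a b \<Longrightarrow> \<sigma> q = Fract (poly_swap a) (poly_swap b)"
    by metis
  then have \<sigma>: "\<sigma> (Fract a b) = Fract (poly_swap a) (poly_swap b)" if "b \<noteq> 0" for a b
    using that by blast
  have "\<sigma> (\<sigma> f) = f" for f
    by (cases f) (simp add: \<sigma>)
  then have "bij \<sigma>"
    by (metis involuntory_imp_bij)
  moreover have "\<sigma> (f + g) = \<sigma> f + \<sigma> g" for f g
    by (cases f; cases g) (simp add: \<sigma> poly_swap_add poly_swap_mult)
  moreover have "\<sigma> (f * g) = \<sigma> f * \<sigma> g" for f g
    by (cases f; cases g) (simp add: \<sigma> poly_swap_mult)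
  moreover have "\<sigma> (ratfun_const c) = ratfun_const c" for c
    by (simp add: ratfun_const_def to_fract_def \<sigma>)
  moreover have "\<sigma> ratfun_X = ratfun_Y" "\<sigma> ratfun_Y = ratfun_X"
    by (simp_all add: ratfun_X_def ratfun_Y_def to_fract_def \<sigma>)
  ultimately show ?thesis
    unfolding ratfun_automorphism_def by blast
qed

lemma ratfun_automorphism_eqI:
  fixes \<sigma> \<tau> :: "'k::field ratfun2 \<Rightarrow> 'k ratfun2"
  assumes "ratfun_automorphism \<sigma>" "ratfun_automorphism \<tau>"
    and X: "\<sigma> ratfun_X = \<tau> ratfun_X" and Y: "\<sigma> ratfun_Y = \<tau> ratfun_Y"
  shows "\<sigma> = \<tau>"
proof
  note hom = assms(1,2)[unfolded ratfun_automorphism_def]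
  have 1: "\<sigma> (to_fract [:p:]) = \<tau> (to_fract [:p:])" for p
  proof (induction p)
    case 0
    have "ratfun_const (0 :: 'k) = 0"
      by (simp add: ratfun_const_def)
    then show ?case using hom by (metis pCons_0_0 to_fract_0)
  next
    case (pCons a p)
    have "to_fract [:pCons a p:] = ratfun_const a + ratfun_X * to_fract [:p:]"
      unfolding ratfun_const_def ratfun_X_def
      by (simp flip: to_fract_add to_fract_mult)
    with pCons.IH X show ?case using hom by simp
  qed
  have 2: "\<sigma> (to_fract P) = \<tau> (to_fract P)" for P
  proof (induction P)
    case 0
    then show ?case using 1[of 0] by simp
  next
    case (pCons a P)
    have "to_fract (pCons a P) = to_fract [:a:] + ratfun_Y * to_fract P"
      unfolding ratfun_Y_def by (simp flip: to_fract_add to_fract_mult)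
    with pCons.IH Y 1 show ?case using hom by simp
  qed
  fix f :: "'k ratfun2"
  obtain a b where f: "f = Fract a b" "b \<noteq> 0"
    by (cases f) auto
  have ab: "f * to_fract b = to_fract a"
    using f by (simp add: to_fract_def eq_fract)
  have "to_fract b \<noteq> 0"
    using f by simp
  moreover have "\<tau> 0 = 0"
    using hom by (metis add_cancel_right_left add.right_neutral)
  ultimately have "\<tau> (to_fract b) \<noteq> 0"
    using hom by (metis bij_pointE)
  moreover have "\<sigma> f * \<tau> (to_fract b) = \<tau> f * \<tau> (to_fract b)"
    using hom ab 2 by metis
  ultimately show "\<sigma> f = \<tau> f"
    by simp
qed

lemma ex1_swap:
  "\<exists>!\<sigma> :: 'k::field ratfun2 \<Rightarrow> 'k ratfun2.
     ratfun_automorphism \<sigma> \<and> \<sigma> ratfun_X = ratfun_Y \<and> \<sigma> ratfun_Y = ratfun_X"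
  using ex_swap by (rule ex_ex1I) (auto intro: ratfun_automorphism_eqI)

lemma ratfun_swap:
  "ratfun_automorphism ratfun_swap"
  "ratfun_swap ratfun_X = ratfun_Y" "ratfun_swap ratfun_Y = ratfun_X"
  using theI'[OF ex1_swap] unfolding ratfun_swap_def by blast+

end

theory Submission
  imports Defs "HOL-Algebra.Algebraic_Closure_Type"
begin

text \<open>
  Put \<open>t = y / x\<close> and \<open>K = k(N\<^sub>a, N\<^sub>b, N\<^sub>c)\<close>. As \<open>gcd(a, b, c) = 1\<close> and
  \<open>x\<^sup>m = N\<^sub>m / (1 + t\<^sup>m)\<close>, the function field is \<open>K(t)\<close>, so it suffices that the minimal
  polynomial of \<open>t\<close> over \<open>K\<close> has no roots besides \<open>t\<close> and \<open>1 / t\<close>, both of them simple.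
  It is separable, since otherwise formal differentiation would induce a nonzero
  \<open>K\<close>-derivation, contradicting the nonvanishing Jacobian of \<open>N\<^sub>a, N\<^sub>b\<close>.

  A conjugate \<open>t'\<close> yields \<open>u, v\<close> with \<open>v / u = t'\<close> and \<open>1 + t\<^sup>m = u\<^sup>m + v\<^sup>m\<close> for
  \<open>m = a, b, c\<close>. Together with the derivative of this relation it shows that the vectors
  \<open>(1)\<close>, \<open>(t\<^sup>m)\<close>, \<open>(u\<^sup>m)\<close>, \<open>(v\<^sup>m)\<close> lie in one plane. Hence \<open>1, t, u, v\<close> are roots of one
  trinomial with exponents \<open>n = a - c\<close>, \<open>r = b - c\<close> and \<open>0\<close>, that is, both \<open>u\<close> and \<open>v\<close> satisfy
  \<open>(1 - t\<^sup>r)(X\<^sup>n - 1) = (1 - t\<^sup>n)(X\<^sup>r - 1)\<close>. The assumptions on \<open>p\<close> make this trinomial split over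
  power series in \<open>t\<close>: by Hensel's lemma there are \<open>n - r\<close> roots with constant term a root of unity
  (``big'') and \<open>r\<close> roots \<open>e t + \<dots>\<close> with \<open>e\<^sup>r = 1\<close> (``small'').

  If \<open>u\<close> or \<open>v\<close> is small, constant terms force \<open>{u, v} = {1, t}\<close>. If both are big and \<open>r > 1\<close>,
  substituting another small root for \<open>t\<close> fixes \<open>u\<close> and \<open>v\<close> but changes \<open>1 + t\<^sup>m\<close>. If both are
  big and \<open>r = 1\<close>, the substitutions \<open>t \<mapsto> t / z\<close> for big roots \<open>z\<close> permute the big roots up to the
  factor \<open>z\<close>; summing the relation over them gives \<open>n t\<^sup>m\<close> as the \<open>m\<close>-th power sum of all roots,
  which is a polynomial in \<open>1 + t + \<dots> + t\<^sup>n\<^sup>-\<^sup>1\<close>. Its values at \<open>0\<close> and at an \<open>(n - 1)\<close>-th root of unity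
  other than \<open>1\<close> agree, a contradiction.
\<close>

hide_const (open) UnivPoly.monom UnivPoly.coeff Polynomials.degree Polynomials.lead_coeff
  Module.smult Coset.order Divisibility.prime

section \<open>Roots of unity and Hensel lifting\<close>

text \<open>\<open>X ^ N - 1\<close> splits into linear factors, and its derivative vanishes at none
  of its roots because \<open>N\<close> is nonzero in the field; hence no root is repeated.\<close>

lemma card_roots_of_unity:
  fixes N :: nat
  assumes "of_nat N \<noteq> (0 :: 'a::alg_closed_field)"
  shows "card {x :: 'a. x ^ N = 1} = N"
proof -
  define p :: "'a poly" where "p = monom 1 N - 1"
  have N: "N > 0"
    using assms by (cases N) auto
  have deg: "degree p = N"
    unfolding p_def using N degree_add_eq_left[of "-1" "monom (1::'a) N"]
    by (simp add: degree_monom_eq)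
  then have "p \<noteq> 0" using N by auto
  then obtain A where A: "size A = N" "p = smult (lead_coeff p) (\<Prod>x\<in>#A. [:-x, 1:])"
    using alg_closed_imp_factorization deg by blast
  have roots: "poly p x = 0 \<longleftrightarrow> x ^ N = 1" for x
    by (simp add: p_def poly_monom)
  have simple: "poly (pderiv p) x \<noteq> 0" if "x ^ N = 1" for x
  proof -
    have "x \<noteq> 0" using N that by (auto simp: zero_power)
    then show ?thesis
      using assms by (simp add: p_def pderiv_diff pderiv_monom poly_monom)
  qed
  have "x \<in># A \<longleftrightarrow> poly p x = 0" for x
  proof -
    have "poly p x = lead_coeff p * (\<Prod>y\<in>#A. x - y)"
      by (subst A(2)) (simp add: poly_prod_mset)
    then show ?thesis using \<open>p \<noteq> 0\<close> by (auto simp: prod_mset_zero_iff)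
  qed
  then have set: "set_mset A = {x. x ^ N = 1}" using roots by blast
  have "count A x \<le> 1" for x
  proof (rule ccontr)
    assume "\<not> count A x \<le> 1"
    then have "{#x, x#} \<subseteq># A"
      by (intro mset_subset_eqI) auto
    then obtain B where "A = {#x, x#} + B" by (metis mset_subset_eq_exists_conv)
    then have "p = [:-x, 1:] * ([:-x, 1:] * smult (lead_coeff p) (\<Prod>x\<in>#B. [:-x, 1:]))"
      by (subst A(2)) simp
    then obtain q where q: "p = [:-x, 1:] * ([:-x, 1:] * q)" by blast
    then have "poly p x = 0" "poly (pderiv p) x = 0"
      by (simp_all only: pderiv_mult) simp_all
    with simple roots show False by blast
  qed
  then have "A = mset_set (set_mset A)"
    by (intro multiset_eqI) (metis count_greater_zero_iff count_mset_set finite_set_mset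
        le_antisym One_nat_def Suc_leI not_in_iff)
  then have "size A = card (set_mset A)" by (metis size_mset_set)
  with A(1) set show ?thesis by simp
qed

text \<open>Leaving the remainder as an unspecified multiple of \<open>d\<^sup>2\<close> avoids
  division by 2, so the expansion is valid in every characteristic.\<close>

lemma poly_taylor2:
  fixes g :: "'a::idom poly"
  shows "\<exists>R. poly g (u + d) = poly g u + d * poly (pderiv g) u + d\<^sup>2 * R"
proof (induction g)
  case 0
  then show ?case by (intro exI[of _ 0]) simp
next
  case (pCons a g)
  then obtain R where "poly g (u + d) = poly g u + d * poly (pderiv g) u + d\<^sup>2 * R" by blast
  then show ?case
    by (intro exI[of _ "poly (pderiv g) u + (u + d) * R"])
      (simp add: pderiv_pCons algebra_simps power2_eq_square)
qed

lemma fps_X_power_dvd_iff: "fps_X ^ N dvd (f :: 'a::field fps) \<longleftrightarrow> (\<forall>i<N. f $ i = 0)"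
proof
  assume "\<forall>i<N. f $ i = 0"
  then have "fps_shift N f * fps_X ^ N = f"
    by (intro fps_ext) (simp add: fps_X_power_mult_right_nth)
  then show "fps_X ^ N dvd f" by (metis dvd_triv_right)
qed (auto simp: fps_X_power_mult_nth elim!: dvdE)

lemma fps_poly_cong_dvd:
  fixes g :: "'a::field fps poly"
  assumes "fps_X ^ N dvd u - v"
  shows "fps_X ^ N dvd poly g u - poly g v"
proof -
  obtain R where "poly g (v + (u - v)) = poly g v + (u - v) * poly (pderiv g) v + (u - v)\<^sup>2 * R"
    using poly_taylor2 by blast
  then have "poly g u - poly g v = (u - v) * (poly (pderiv g) v + (u - v) * R)"
    by (simp add: power2_eq_square algebra_simps)
  then show ?thesis using assms by simp
qed

lemma fps_poly_cong_nth_0: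
  fixes g :: "'a::field fps poly"
  assumes "u $ 0 = v $ 0"
  shows "poly g u $ 0 = poly g v $ 0"
  using fps_poly_cong_dvd[of 1 u v g] assms unfolding fps_X_power_dvd_iff by simp

text \<open>By Taylor expansion at \<open>u\<close>, the product of \<open>v - u\<close> with a
  series of nonzero constant term is zero.\<close>

lemma fps_hensel_unique:
  fixes g :: "'a::field fps poly"
  assumes "poly g u = 0" "poly g v = 0" "u $ 0 = v $ 0" "poly (pderiv g) u $ 0 \<noteq> 0"
  shows "u = v"
proof -
  obtain R where R: "poly g (u + (v - u)) = poly g u + (v - u) * poly (pderiv g) u + (v - u)\<^sup>2 * R"
    using poly_taylor2 by blast
  define S where "S = poly (pderiv g) u + (v - u) * R"
  have "(v - u) * S = 0"
    using R assms(1,2) by (simp add: S_def power2_eq_square algebra_simps)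
  moreover have "S $ 0 \<noteq> 0" using assms(3,4) by (simp add: S_def)
  ultimately show ?thesis by auto
qed

text \<open>Newton iteration with the derivative frozen at its constant term \<open>d\<close>: as
  \<open>d\<close> is invertible, each stage can correct one more coefficient.\<close>

lemma fps_hensel_exists:
  fixes g :: "'a::field fps poly"
  assumes root: "poly g (fps_const e) $ 0 = 0" and simple: "poly (pderiv g) (fps_const e) $ 0 \<noteq> 0"
  shows "\<exists>u. u $ 0 = e \<and> poly g u = 0"
proof -
  define d where "d = poly (pderiv g) (fps_const e) $ 0"
  \<comment> \<open>\<open>U N\<close> will be a root modulo \<open>fps_X ^ Suc N\<close>; the next
    stage alters only coefficient \<open>Suc N\<close>, to cancel the first possible error.\<close>
  define U where "U = rec_nat (fps_const e) (\<lambda>N u. u + fps_const (- (poly g u $ Suc N) / d) * fps_X ^ Suc N)"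
  have U0: "U 0 = fps_const e"
    and US: "U (Suc N) = U N + fps_const (- (poly g (U N) $ Suc N) / d) * fps_X ^ Suc N" for N
    by (simp_all add: U_def)
  have nth_U: "U (Suc N) $ i = (if i = Suc N then U N $ i - poly g (U N) $ i / d else U N $ i)" for N i
    by (simp add: US fps_X_power_nth del: power_Suc)
  have const: "U N $ 0 = e" for N
    by (induction N) (simp_all add: nth_U, simp add: U0)
  have inv: "fps_X ^ Suc N dvd poly g (U N)" for N
  proof (induction N)
    case 0
    show ?case unfolding fps_X_power_dvd_iff using root by (simp add: U0)
  next
    case (Suc N)
    define c where "c = - (poly g (U N) $ Suc N) / d"
    obtain R where "poly g (U N + fps_const c * fps_X ^ Suc N) = poly g (U N)
        + (fps_const c * fps_X ^ Suc N) * poly (pderiv g) (U N) + (fps_const c * fps_X ^ Suc N)\<^sup>2 * R"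
      using poly_taylor2 by blast
    then have eq: "poly g (U (Suc N)) = poly g (U N) + fps_X ^ Suc N * (fps_const c *
        (poly (pderiv g) (U N) + (fps_const c * fps_X ^ Suc N) * R))"
      by (simp add: US c_def power2_eq_square algebra_simps)
    have "poly (pderiv g) (U N) $ 0 = d"
      unfolding d_def by (rule fps_poly_cong_nth_0) (simp add: const)
    then have "(fps_const c * (poly (pderiv g) (U N) + (fps_const c * fps_X ^ Suc N) * R)) $ 0 = c * d"
      by simp
    moreover have "c * d = - (poly g (U N) $ Suc N)"
      using simple by (simp add: c_def d_def)
    ultimately have "poly g (U (Suc N)) $ i = 0" if "i \<le> Suc N" for i
      using Suc that unfolding eq
      by (auto simp: fps_X_power_dvd_iff fps_X_power_mult_nth le_Suc_eq simp del: power_Suc)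
    then show ?case by (auto simp: fps_X_power_dvd_iff simp del: power_Suc)
  qed
  \<comment> \<open>Coefficient \<open>i\<close> is final from stage \<open>i\<close> on, so the
    diagonal is the X-adic limit of the stages.\<close>
  define W where "W = Abs_fps (\<lambda>i. U i $ i)"
  have stable: "U (i + k) $ i = U i $ i" for i k
    by (induction k) (simp_all add: nth_U)
  have "fps_X ^ N dvd poly g W" for N
  proof -
    have "W $ i = U N $ i" if "i < N" for i
      using stable[of i "N - i"] that by (simp add: W_def)
    then have "fps_X ^ N dvd W - U N" by (simp add: fps_X_power_dvd_iff)
    then have "fps_X ^ N dvd poly g W - poly g (U N)" by (rule fps_poly_cong_dvd)
    moreover have "fps_X ^ N dvd poly g (U N)"
      using inv[of N] by (simp add: fps_X_power_dvd_iff del: power_Suc)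
    ultimately show ?thesis by (simp add: dvd_diff_left_iff)
  qed
  then have "poly g W = 0"
    by (intro fps_ext) (metis fps_X_power_dvd_iff fps_zero_nth lessI)
  moreover have "W $ 0 = e" using const by (simp add: W_def)
  ultimately show ?thesis by blast
qed

section \<open>Roots of the trinomial over power series\<close>

text \<open>
  Up to scaling, there is only one trinomial with exponents \<open>n\<close>, \<open>r\<close>, \<open>0\<close> vanishing at \<open>1\<close> and \<open>s\<close>;
  the condition says that \<open>u\<close> is a root of it.
\<close>

definition tri_root :: "nat \<Rightarrow> nat \<Rightarrow> 'a::comm_ring_1 \<Rightarrow> 'a \<Rightarrow> bool" where
  "tri_root n r s u \<longleftrightarrow> (1 - s ^ r) * (u ^ n - 1) = (1 - s ^ n) * (u ^ r - 1)"

lemma tri_root_self: "tri_root n r s s"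
  by (simp add: tri_root_def algebra_simps)

lemma tri_root_one: "tri_root n r s 1"
  by (simp add: tri_root_def)

text \<open>The roots \<open>1\<close> and \<open>t\<close> fix the trinomial up to a factor, so
  another root \<open>s\<close> can replace \<open>t\<close> as the parameter.\<close>

lemma tri_root_trans:
  fixes s t u :: "'a::idom"
  assumes "tri_root n r t s" "tri_root n r t u" "t ^ r \<noteq> 1"
  shows "tri_root n r s u"
proof -
  have "(1 - t ^ r) * ((1 - s ^ r) * (u ^ n - 1)) = (1 - s ^ r) * ((1 - t ^ r) * (u ^ n - 1))"
    by (simp add: mult_ac)
  also have "\<dots> = (1 - t ^ n) * (1 - s ^ r) * (u ^ r - 1)"
    using assms(2) by (simp add: tri_root_def mult_ac)
  also have "(1 - t ^ n) * (1 - s ^ r) = (1 - t ^ r) * (1 - s ^ n)"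
    using assms(1) by (simp add: tri_root_def algebra_simps)
  finally show ?thesis using assms(3) by (simp add: tri_root_def mult.assoc)
qed

text \<open>Rescaling the variable by \<open>u\<close> turns the roots \<open>1\<close>,
  \<open>s\<close>, \<open>u\<close>, \<open>v\<close> of one trinomial into \<open>u'\<close>,
  \<open>s * u'\<close>, \<open>1\<close>, \<open>v * u'\<close>. The inverse is passed as
  \<open>u'\<close> because power series do not form a field.\<close>

lemma tri_root_divide:
  fixes s u v :: "'a::idom"
  assumes "tri_root n r s u" "tri_root n r s v" "s ^ r \<noteq> 1" "u * u' = 1"
  shows "tri_root n r (s * u') (v * u')"
proof -
  have pow: "u ^ k * u' ^ k = 1" for k
    using assms(4) by (simp flip: power_mult_distrib)
  \<comment> \<open>The trinomial relation with base point \<open>u\<close> in place of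
    \<open>1\<close>, obtained from differences of the given relations.\<close>
  have eq: "(u ^ r - s ^ r) * (v ^ n - u ^ n) = (u ^ n - s ^ n) * (v ^ r - u ^ r)"
  proof -
    have *: "(1 - s ^ r) * (u ^ n - s ^ n) = (1 - s ^ n) * (u ^ r - s ^ r)"
      and "(1 - s ^ r) * (v ^ n - u ^ n) = (1 - s ^ n) * (v ^ r - u ^ r)"
      using arg_cong2[where f = "(-)", OF assms(1)[unfolded tri_root_def] tri_root_self[of n r s, unfolded tri_root_def]]
        arg_cong2[where f = "(-)", OF assms(2)[unfolded tri_root_def] assms(1)[unfolded tri_root_def]]
      by (simp_all flip: right_diff_distrib)
    then have "(1 - s ^ r) * ((u ^ r - s ^ r) * (v ^ n - u ^ n)) = (u ^ r - s ^ r) * ((1 - s ^ n) * (v ^ r - u ^ r))"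
      by (metis mult.left_commute)
    also have "\<dots> = (1 - s ^ r) * ((u ^ n - s ^ n) * (v ^ r - u ^ r))"
      using * by (metis mult.assoc mult.commute)
    finally show ?thesis using assms(3) by simp
  qed
  have "(1 - (s * u') ^ r) * ((v * u') ^ n - 1) = (u ^ r * u' ^ r - s ^ r * u' ^ r) * (v ^ n * u' ^ n - u ^ n * u' ^ n)"
    by (simp add: pow power_mult_distrib)
  also have "\<dots> = (u ^ r - s ^ r) * (v ^ n - u ^ n) * (u' ^ r * u' ^ n)"
    by (simp add: algebra_simps)
  also have "\<dots> = (u ^ n * u' ^ n - s ^ n * u' ^ n) * (v ^ r * u' ^ r - u ^ r * u' ^ r)"
    unfolding eq by (simp add: algebra_simps)
  also have "\<dots> = (1 - (s * u') ^ n) * ((v * u') ^ r - 1)"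
    by (simp add: pow power_mult_distrib)
  finally show ?thesis by (simp add: tri_root_def)
qed

text \<open>Euclid's algorithm on the exponents, cancelling powers of \<open>v\<close> at each
  division step.\<close>

lemma power_gcd_eq:
  fixes u v :: "'a::idom"
  assumes "u ^ i = v ^ i" "u ^ j = v ^ j" "v \<noteq> 0"
  shows "u ^ gcd i j = v ^ gcd i j"
  using assms(1,2)
proof (induction i j rule: gcd_nat_induct)
  case (step m n)
  have "u ^ (n * (m div n)) * u ^ (m mod n) = v ^ (n * (m div n)) * v ^ (m mod n)"
    using step.prems by (simp flip: power_add)
  moreover have "u ^ (n * (m div n)) = v ^ (n * (m div n))"
    using step.prems by (simp add: power_mult)
  ultimately have "u ^ (m mod n) = v ^ (m mod n)"
    using assms(3) by simp
  then show ?case using step.IH step.prems(2) by (simp add: gcd_red_nat[of m n])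
qed auto

lemma coprime_powers_eq:
  fixes u v :: "'a::idom"
  assumes "Gcd {a, b, c} = 1" and "\<And>m. m \<in> {a, b, c} \<Longrightarrow> u ^ m = v ^ m" and "v \<noteq> 0"
  shows "u = v"
proof -
  have "u ^ gcd a (gcd b c) = v ^ gcd a (gcd b c)"
    by (intro power_gcd_eq assms) auto
  then show ?thesis using assms(1) by simp
qed

lemma fps_tri_root_nth_0:
  fixes s u :: "'a::field fps"
  assumes "tri_root n r s u" "s $ 0 = 0" "u $ 0 \<noteq> 0" "0 < r" "r < n"
  shows "(u $ 0) ^ (n - r) = 1"
proof -
  have "((1 - s ^ r) * (u ^ n - 1)) $ 0 = ((1 - s ^ n) * (u ^ r - 1)) $ 0"
    using assms(1) by (simp add: tri_root_def)
  then have "(u $ 0) ^ n = (u $ 0) ^ r"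
    using assms by (simp add: fps_power_zeroth zero_power)
  then show ?thesis using assms by (simp add: power_diff)
qed

text \<open>Constant terms of roots satisfy \<open>z ^ n = z ^ r\<close>. The nonzero solutions are
  the roots of unity of order dividing \<open>n - r\<close>, and they are simple because
  \<open>n - r\<close> is nonzero in the field; Hensel's lemma gives exactly one series over
  each.\<close>

lemma fps_big_tri_root:
  fixes s :: "'a::field fps"
  assumes "s $ 0 = 0" "0 < r" "r < n" "of_nat (n - r) \<noteq> (0 :: 'a)"
  shows "e ^ (n - r) = 1 \<Longrightarrow> \<exists>u. u $ 0 = e \<and> tri_root n r s u"
    and "tri_root n r s u \<Longrightarrow> tri_root n r s v \<Longrightarrow> u $ 0 = v $ 0 \<Longrightarrow> u $ 0 \<noteq> 0 \<Longrightarrow> u = v"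
proof -
  define g where "g = monom (1 - s ^ r) n - monom (1 - s ^ n) r + [:s ^ r - s ^ n:]"
  have "poly g x = (1 - s ^ r) * (x ^ n - 1) - (1 - s ^ n) * (x ^ r - 1)" for x
    by (simp add: g_def poly_monom algebra_simps)
  then have g: "poly g x = 0 \<longleftrightarrow> tri_root n r s x" for x
    by (simp add: tri_root_def)
  have pow: "of_nat n * x ^ (n - 1) - of_nat r * x ^ (r - 1) = of_nat (n - r) * x ^ (r - 1)"
    if "x ^ (n - r) = 1" for x :: 'a
  proof -
    have "x ^ (n - 1) = x ^ (r - 1)" using power_add[of x "n - r" "r - 1"] that assms by simp
    then show ?thesis using assms by (simp add: of_nat_diff algebra_simps)
  qed
  have g': "poly (pderiv g) x $ 0 \<noteq> 0" if "(x $ 0) ^ (n - r) = 1" for x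
  proof -
    have "x $ 0 \<noteq> 0" using that assms by (auto simp: zero_power)
    moreover have "poly (pderiv g) x $ 0 = of_nat n * (x $ 0) ^ (n - 1) - of_nat r * (x $ 0) ^ (r - 1)"
      using assms by (simp add: g_def pderiv_diff pderiv_add pderiv_monom poly_monom fps_power_zeroth
          zero_power pderiv_pCons fps_nth_of_nat)
    ultimately show ?thesis using pow that assms(4) by simp
  qed
  show "\<exists>u. u $ 0 = e \<and> tri_root n r s u" if e: "e ^ (n - r) = 1"
  proof -
    have "e ^ n = e ^ r" using power_add[of e "n - r" r] e assms by simp
    then have "poly g (fps_const e) $ 0 = 0"
      using assms by (simp add: g_def poly_monom fps_power_zeroth zero_power)
    then show ?thesis
      using fps_hensel_exists[of g e] g' e by (simp add: g)
  qed
  show "u = v" if roots: "tri_root n r s u" "tri_root n r s v" and eq: "u $ 0 = v $ 0" "u $ 0 \<noteq> 0"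
  proof (rule fps_hensel_unique)
    show "poly g u = 0" "poly g v = 0" using roots by (simp_all only: g)
    show "poly (pderiv g) u $ 0 \<noteq> 0"
      using fps_tri_root_nth_0[OF roots(1) assms(1) eq(2) assms(2,3)] by (rule g')
  qed (fact eq(1))
qed

text \<open>All small roots have constant term 0, so Hensel's lemma is applied after writing
  \<open>u = fps_X * q\<close> and dividing by \<open>fps_X ^ r\<close>. The result is
  \<open>g\<close>, which modulo \<open>fps_X\<close> is \<open>1 - q ^ r\<close> and has simple
  roots.\<close>

lemma fps_small_tri_root:
  fixes e :: "'a::field"
  assumes "0 < r" "r < n" "of_nat r \<noteq> (0 :: 'a)" "e ^ r = 1"
  shows "\<exists>u. u $ 0 = 0 \<and> u $ 1 = e \<and> tri_root n r fps_X u"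
proof -
  define g :: "'a fps poly" where
    "g = monom ((1 - fps_X ^ r) * fps_X ^ (n - r)) n - monom (1 - fps_X ^ n) r + [:1 - fps_X ^ (n - r):]"
  have X: "fps_X ^ n = fps_X ^ r * (fps_X ^ (n - r) :: 'a fps)"
    using assms by (simp flip: power_add)
  have "e \<noteq> 0" using assms by (auto simp: zero_power)
  have "poly g (fps_const e) $ 0 = 0"
    using assms by (simp add: g_def poly_monom fps_power_zeroth zero_power)
  moreover have "poly (pderiv g) (fps_const e) $ 0 \<noteq> 0"
    using assms \<open>e \<noteq> 0\<close> by (simp add: g_def pderiv_diff pderiv_add pderiv_monom poly_monom fps_power_zeroth
          zero_power pderiv_pCons fps_nth_of_nat)
  ultimately obtain q where q: "q $ 0 = e" "poly g q = 0"
    using fps_hensel_exists[of g e] by blast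
  have "0 = fps_X ^ r * poly g q" using q(2) by simp
  also have "\<dots> = (1 - fps_X ^ r) * ((fps_X ^ r * fps_X ^ (n - r)) * q ^ n)
      - (1 - fps_X ^ n) * (fps_X ^ r * q ^ r) + (fps_X ^ r - fps_X ^ r * fps_X ^ (n - r))"
    by (simp add: g_def poly_monom right_diff_distrib distrib_left mult_ac)
  also have "\<dots> = (1 - fps_X ^ r) * ((fps_X * q) ^ n - 1) - (1 - fps_X ^ n) * ((fps_X * q) ^ r - 1)"
    unfolding X[symmetric] power_mult_distrib by (simp add: algebra_simps)
  finally have "tri_root n r fps_X (fps_X * q)"
    by (simp add: tri_root_def)
  then show ?thesis using q(1) by (intro exI[of _ "fps_X * q"]) simp
qed

lemma fps_tri_root_compose:
  assumes "tri_root n r fps_X u" "s $ 0 = 0"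
  shows "tri_root n r (s :: 'a::field fps) (u oo s)"
proof -
  have "((1 - fps_X ^ r) * (u ^ n - 1)) oo s = ((1 - fps_X ^ n) * (u ^ r - 1)) oo s"
    using assms by (simp add: tri_root_def)
  then show ?thesis
    using assms(2) by (simp add: tri_root_def fps_compose_mult_distrib fps_compose_sub_distrib
        flip: fps_compose_power)
qed

text \<open>Newton's identities, read off from the logarithmic derivative of the product of the
  \<open>1 - x i * X\<close>. Solving them for the highest power sum involves no division, so they
  work over any subring and in every characteristic.\<close>

lemma power_sum_in_subring:
  fixes x :: "'b \<Rightarrow> 'a::idom"
  assumes "finite I" "0 \<in> R" "\<And>f g. f \<in> R \<Longrightarrow> g \<in> R \<Longrightarrow> f + g \<in> R \<and> f * g \<in> R \<and> - f \<in> R" "1 \<in> R"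
    and coeffs: "\<And>j. coeff (\<Prod>i\<in>I. [:1, - x i:]) j \<in> R"
  shows "0 < m \<Longrightarrow> (\<Sum>i\<in>I. x i ^ m) \<in> R"
proof (induction m rule: less_induct)
  case (less m)
  define P where "P = (\<lambda>J. \<Prod>i\<in>J. [:1, - x i:])"
  define F where "F = fps_of_poly (P I)"
  define S where "S = Abs_fps (\<lambda>k. \<Sum>i\<in>I. x i ^ Suc k)"
  have sum_R: "sum f A \<in> R" if "\<And>a. a \<in> A \<Longrightarrow> f a \<in> R" for f and A :: "nat set"
    using that by (induction A rule: infinite_finite_induct) (auto simp: assms)
  have of_nat_R: "of_nat k \<in> R" for k
    by (induction k) (auto simp: assms)
  \<comment> \<open>The geometric series, shifted by one so that coefficient \<open>k\<close>
    carries the power \<open>Suc k\<close>.\<close>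
  have geom: "fps_of_poly [:1, - x i:] * Abs_fps (\<lambda>k. x i ^ Suc k) = fps_const (x i)" for i
  proof (rule fps_ext)
    show "(fps_of_poly [:1, - x i:] * Abs_fps (\<lambda>k. x i ^ Suc k)) $ k = fps_const (x i) $ k" for k
      by (cases k) (simp_all add: fps_of_poly_pCons ring_distribs mult.assoc)
  qed
  have deriv: "fps_deriv F = - (F * S)"
  proof -
    have "pderiv (P I) = (\<Sum>i\<in>I. smult (- x i) (P (I - {i})))"
      unfolding P_def by (subst pderiv_prod) (simp add: pderiv_pCons)
    then have "fps_deriv F = (\<Sum>i\<in>I. - (fps_const (x i) * fps_of_poly (P (I - {i}))))"
      by (simp add: F_def fps_of_poly_pderiv[symmetric] fps_of_poly_sum fps_of_poly_smult fps_of_poly_uminus)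
    also have "\<dots> = (\<Sum>i\<in>I. - (F * Abs_fps (\<lambda>k. x i ^ Suc k)))"
    proof (intro sum.cong refl)
      fix i assume "i \<in> I"
      then have "F = fps_of_poly [:1, - x i:] * fps_of_poly (P (I - {i}))"
        unfolding F_def P_def using assms(1) by (subst prod.remove) (simp_all add: fps_of_poly_mult)
      then have "F * Abs_fps (\<lambda>k. x i ^ Suc k) = fps_const (x i) * fps_of_poly (P (I - {i}))"
        using geom[of i] by (simp add: mult_ac)
      then show "- (fps_const (x i) * fps_of_poly (P (I - {i}))) = - (F * Abs_fps (\<lambda>k. x i ^ Suc k))"
        by simp
    qed
    also have "\<dots> = - (F * S)"
    proof -
      have "S = (\<Sum>i\<in>I. Abs_fps (\<lambda>k. x i ^ Suc k))"
        by (intro fps_ext) (simp add: S_def fps_sum_nth)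
      then show ?thesis by (simp add: sum_distrib_left sum_negf)
    qed
    finally show ?thesis .
  qed
  obtain k where m: "m = Suc k" using less.prems gr0_implies_Suc by blast
  have "F $ 0 = 1"
    by (simp add: F_def P_def poly_prod flip: poly_0_coeff_0)
  have neg: "d = - (e + f) \<Longrightarrow> e = - d + - f" for d e f :: 'a
    by simp
  have "fps_deriv F $ k = - (\<Sum>i=0..k. F $ i * S $ (k - i))"
    by (simp add: deriv fps_mult_nth)
  also have "(\<Sum>i=0..k. F $ i * S $ (k - i)) = S $ k + (\<Sum>i=1..k. F $ i * S $ (k - i))"
    using \<open>F $ 0 = 1\<close> by (simp add: sum.atLeast_Suc_atMost)
  finally have "S $ k = - (fps_deriv F $ k) + - (\<Sum>i=1..k. F $ i * S $ (k - i))"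
    using neg by blast
  moreover have F_R: "F $ j \<in> R" for j
    using coeffs by (simp add: F_def P_def)
  then have "fps_deriv F $ k \<in> R"
    by (simp add: assms of_nat_R del: of_nat_Suc)
  moreover have "S $ (k - i) \<in> R" if "i \<in> {1..k}" for i
    using less.IH[of "Suc (k - i)"] that by (simp add: S_def m)
  then have "(\<Sum>i=1..k. F $ i * S $ (k - i)) \<in> R"
    by (intro sum_R) (simp add: assms F_R)
  ultimately have "S $ k \<in> R" by (simp only: assms(3))
  then show ?case by (simp add: S_def m)
qed

text \<open>Replacing \<open>fps_X\<close> by \<open>fps_X / x e\<close> carries the big root with
  constant term \<open>w\<close> to \<open>x (e * w) / x e\<close>. Doing this to \<open>eq\<close>
  for every \<open>e\<close> and summing gives \<open>S + card * fps_X ^ m = S + S\<close>, where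
  \<open>S\<close> is the sum on the right.\<close>

lemma big_tri_roots_power_sum:
  fixes u v :: "'a::field fps" and x :: "'a \<Rightarrow> 'a fps"
  assumes r: "0 < r" "r < n" "of_nat (n - r) \<noteq> (0 :: 'a)"
    and u: "tri_root n r fps_X u" "u $ 0 \<noteq> 0" and v: "tri_root n r fps_X v" "v $ 0 \<noteq> 0"
    and x: "\<And>e. e ^ (n - r) = 1 \<Longrightarrow> x e $ 0 = e \<and> tri_root n r fps_X (x e)"
    and eq: "1 + fps_X ^ m = u ^ m + v ^ m"
  shows "of_nat (card {e :: 'a. e ^ (n - r) = 1}) * fps_X ^ m = (\<Sum>e | e ^ (n - r) = 1. x e ^ m)"
proof -
  define B where "B = {e :: 'a. e ^ (n - r) = 1}"
  have u0: "(u $ 0) ^ (n - r) = 1" and v0: "(v $ 0) ^ (n - r) = 1"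
    using fps_tri_root_nth_0[of n r fps_X] u v r by auto
  have X: "fps_X ^ r \<noteq> (1 :: 'a fps)"
    using r(1) by (metis fps_X_power_nth fps_one_nth not_gr_zero zero_neq_one)
  have rotate: "x e ^ m + fps_X ^ m = x (e * u $ 0) ^ m + x (e * v $ 0) ^ m" if e: "e \<in> B" for e
  proof -
    have e0: "e \<noteq> 0" using e r by (auto simp: B_def zero_power)
    define y where "y = inverse (x e)"
    have y: "x e * y = 1" "y $ 0 = inverse e"
      using x[of e] e e0 by (simp_all add: y_def B_def inverse_mult_eq_1' fps_inverse_nth_0)
    define s where "s = fps_X * y"
    have s0: "s $ 0 = 0" by (simp add: s_def)
    \<comment> \<open>Both sides are roots for the parameter \<open>s\<close> with constant term
      \<open>w $ 0\<close>, so uniqueness of big roots identifies them.\<close>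
    have transport: "w oo s = x (e * w $ 0) * y" if w: "tri_root n r fps_X w" "w $ 0 \<noteq> 0" for w
    proof -
      have w0: "(w $ 0) ^ (n - r) = 1"
        using fps_tri_root_nth_0[of n r fps_X w] w r by simp
      have ew: "(e * w $ 0) ^ (n - r) = 1"
        using e w0 by (simp add: B_def power_mult_distrib)
      have "tri_root n r s (w oo s)"
        using fps_tri_root_compose[OF w(1) s0] .
      moreover have "tri_root n r s (x (e * w $ 0) * y)"
        unfolding s_def using x[OF ew] x[of e] e y(1) X by (intro tri_root_divide) (auto simp: B_def)
      moreover have "(w oo s) $ 0 = (x (e * w $ 0) * y) $ 0"
        using x[OF ew] y(2) e0 by simp
      ultimately show ?thesis
        using fps_big_tri_root(2)[OF s0 r] w(2) by simp
    qed
    have "(1 + fps_X ^ m) oo s = (u ^ m + v ^ m) oo s"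
      by (simp only: eq)
    then have "1 + s ^ m = (u oo s) ^ m + (v oo s) ^ m"
      using s0 by (simp add: fps_compose_add_distrib flip: fps_compose_power)
    then have "x e ^ m * (1 + (fps_X * y) ^ m) = x e ^ m * ((x (e * u $ 0) * y) ^ m + (x (e * v $ 0) * y) ^ m)"
      using transport u v by (simp add: s_def)
    moreover have "x e ^ m * (z * y) ^ m = z ^ m" for z
      using y(1) by (metis mult.assoc mult.commute mult_1 power_mult_distrib)
    ultimately show ?thesis by (simp add: distrib_left)
  qed
  have shift: "(\<Sum>e\<in>B. x (e * w) ^ m) = (\<Sum>e\<in>B. x e ^ m)" if w: "w ^ (n - r) = 1" for w
  proof -
    have "w \<noteq> 0" using w r by (auto simp: zero_power)
    then have "bij_betw (\<lambda>e. e * w) B B"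
      using w by (intro bij_betwI[of _ _ _ "\<lambda>e. e / w"]) (auto simp: B_def power_mult_distrib power_divide)
    then show ?thesis by (rule sum.reindex_bij_betw)
  qed
  have "(\<Sum>e\<in>B. x e ^ m) + of_nat (card B) * fps_X ^ m = (\<Sum>e\<in>B. x e ^ m) + (\<Sum>e\<in>B. x e ^ m)"
    using sum.cong[OF refl rotate, of B] shift[OF u0] shift[OF v0] by (simp add: sum.distrib)
  then show ?thesis by (simp add: B_def)
qed

text \<open>A polynomial in \<open>A\<close> cannot separate \<open>0\<close> from \<open>e\<close>,
  but a nonconstant monomial vanishes at \<open>0\<close> only.\<close>

lemma monom_not_pcompose:
  fixes A :: "'a::idom poly"
  assumes "monom k m = pcompose Q A" "k \<noteq> 0" "0 < m" "poly A 0 = poly A e" "e \<noteq> 0"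
  shows False
proof -
  have "poly (monom k m) 0 = poly (monom k m) e"
    using assms(4) by (simp add: assms(1) poly_pcompose)
  then show False using assms(2,3,5) by (simp add: poly_monom zero_power)
qed

lemma no_big_tri_roots:
  fixes u v :: "'a::alg_closed_field fps"
  assumes n: "1 < n" "of_nat n \<noteq> (0 :: 'a)" "of_nat (n - 1) \<noteq> (0 :: 'a)"
    and u: "tri_root n 1 fps_X u" "u $ 0 \<noteq> 0" "u $ 0 \<noteq> 1" and v: "tri_root n 1 fps_X v" "v $ 0 \<noteq> 0"
    and m: "0 < m" "1 + fps_X ^ m = u ^ m + v ^ m"
  shows False
proof -
  define B where "B = {e :: 'a. e ^ (n - 1) = 1}"
  have card_B: "card B = n - 1"
    unfolding B_def by (rule card_roots_of_unity) (fact n(3))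
  have finite_B: "finite B" using card_B n(1) by (metis card.infinite less_irrefl zero_less_diff)
  obtain x :: "'a \<Rightarrow> 'a fps" where x: "\<And>e. e ^ (n - 1) = 1 \<Longrightarrow> x e $ 0 = e \<and> tri_root n 1 fps_X (x e)"
  proof -
    have "\<forall>e. \<exists>u. e ^ (n - 1) = 1 \<longrightarrow> u $ 0 = e \<and> tri_root n 1 (fps_X :: 'a fps) u"
      using fps_big_tri_root(1)[of "fps_X :: 'a fps" 1 n] n by auto
    from choice[OF this] show ?thesis using that by blast
  qed
  have "0 \<notin> B" using n(1) by (auto simp: B_def zero_power)
  \<comment> \<open>All roots are indexed by their constant terms; index \<open>0\<close> stands for
    \<open>fps_X\<close>, the small root when \<open>r = 1\<close>.\<close>
  define y where "y = (\<lambda>e. if e = 0 then fps_X else x e)"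
  define I where "I = insert 0 B"
  have y: "y e $ 0 = e" "tri_root n 1 fps_X (y e)" if "e \<in> I" for e
    using that x[of e] by (auto simp: y_def I_def B_def tri_root_self)
  have I: "finite I" "card I = n"
    using finite_B \<open>0 \<notin> B\<close> card_B n(1) by (auto simp: I_def)
  have sum_y: "(\<Sum>e\<in>I. y e ^ m) = of_nat n * fps_X ^ m"
  proof -
    have "(\<Sum>e\<in>B. y e ^ m) = (\<Sum>e\<in>B. x e ^ m)"
      using \<open>0 \<notin> B\<close> by (intro sum.cong) (auto simp: y_def)
    also have "\<dots> = of_nat (n - 1) * fps_X ^ m"
      using big_tri_roots_power_sum[of 1 n u v x m] n u v x m card_B by (simp add: B_def)
    finally show ?thesis
      using finite_B \<open>0 \<notin> B\<close> n(1) by (simp add: I_def y_def of_nat_diff algebra_simps)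
  qed
  define A :: "'a poly" where "A = (\<Sum>i<n. monom 1 i)"
  have A_X: "fps_of_poly A * (1 - fps_X) = 1 - fps_X ^ n"
    using one_diff_power_eq[of "fps_X :: 'a fps" n] by (simp add: A_def fps_of_poly_sum fps_of_poly_monom' mult.commute)
  \<comment> \<open>The ring of polynomials in \<open>A\<close>, viewed inside the power
    series.\<close>
  define R where "R = range (\<lambda>Q. fps_of_poly (pcompose Q A))"
  \<comment> \<open>The trinomial divided by the common factor \<open>1 - fps_X\<close>; it is monic
    with coefficients in \<open>R\<close>.\<close>
  define f where "f = monom 1 n - monom (fps_of_poly A) 1 + [:fps_of_poly A - 1:]"
  have poly_f: "poly f z = z ^ n - 1 - fps_of_poly A * (z - 1)" for z
    by (simp add: f_def poly_monom algebra_simps)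
  have f_root: "poly f (y e) = 0" if "e \<in> I" for e
  proof -
    have "(1 - fps_X) * (y e ^ n - 1) = (1 - fps_X) * (fps_of_poly A * (y e - 1))"
      using y(2)[OF that] by (simp add: tri_root_def A_X[symmetric] mult_ac)
    moreover have "1 - fps_X \<noteq> (0 :: 'a fps)" by (metis diff_eq_diff_eq diff_zero diff_self fps_X_neq_one)
    ultimately show ?thesis by (simp add: poly_f)
  qed
  have deg_f: "degree f = n" "coeff f n = 1"
  proof -
    have c: "coeff f k = (if k = n then 1 else 0)" if "k \<ge> n" for k
      using that n(1) by (auto simp: f_def coeff_pCons split: nat.splits)
    then show "coeff f n = 1" by simp
    with c show "degree f = n" by (intro antisym degree_le le_degree) auto
  qed
  \<comment> \<open>Two monic polynomials of degree \<open>n\<close> with \<open>n\<close> distinct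
    common roots coincide, since their difference has smaller degree.\<close>
  have f_prod: "f = (\<Prod>e\<in>I. [:- y e, 1:])"
  proof (rule ccontr)
    define P where "P = (\<Prod>e\<in>I. [:- y e, 1:])"
    assume "f \<noteq> (\<Prod>e\<in>I. [:- y e, 1:])"
    then have "f - P \<noteq> 0" by (simp add: P_def)
    have "degree P = n"
      unfolding P_def using I by (simp add: degree_prod_eq_sum_degree)
    moreover have "lead_coeff P = 1"
      unfolding P_def by (simp only: lead_coeff_prod) simp
    ultimately have P: "degree P = n" "coeff P n = 1" by simp_all
    then have "degree (f - P) < n"
      using deg_f P \<open>f - P \<noteq> 0\<close> degree_diff_le[of f n P]
      by (metis coeff_diff diff_self leading_coeff_0_iff le_neq_implies_less order_refl)
    moreover have "y ` I \<subseteq> {z. poly (f - P) z = 0}"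
    proof
      fix z assume "z \<in> y ` I"
      then obtain e where e: "e \<in> I" "z = y e" by blast
      then have "poly P z = 0"
        unfolding P_def poly_prod using I(1) by (intro prod_zero bexI[of _ e]) simp_all
      then show "z \<in> {z. poly (f - P) z = 0}" using f_root e by simp
    qed
    then have "card (y ` I) \<le> card {z. poly (f - P) z = 0}"
      by (rule card_mono[OF poly_roots_finite[OF \<open>f - P \<noteq> 0\<close>]])
    moreover have "inj_on y I"
      by (rule inj_onI) (metis y(1))
    then have "card (y ` I) = n"
      using I(2) by (simp add: card_image)
    ultimately show False
      using card_poly_roots_bound[OF \<open>f - P \<noteq> 0\<close>] by simp
  qed
  have closed: "0 \<in> R" "1 \<in> R" "g + h \<in> R \<and> g * h \<in> R \<and> - g \<in> R" if gh: "g \<in> R" "h \<in> R" for g h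
  proof -
    obtain G H where "g = fps_of_poly (pcompose G A)" "h = fps_of_poly (pcompose H A)"
      using gh by (auto simp: R_def)
    then have "g + h = fps_of_poly (pcompose (G + H) A)" "g * h = fps_of_poly (pcompose (G * H) A)"
      "- g = fps_of_poly (pcompose (- G) A)"
      by (simp_all add: fps_of_poly_add fps_of_poly_mult fps_of_poly_uminus pcompose_add pcompose_mult pcompose_uminus)
    then show "g + h \<in> R \<and> g * h \<in> R \<and> - g \<in> R" by (auto simp: R_def)
    show "0 \<in> R" unfolding R_def by (rule range_eqI[of _ _ 0]) simp
    show "1 \<in> R" unfolding R_def by (rule range_eqI[of _ _ 1]) (simp add: pcompose_1)
  qed
  have A_R: "fps_of_poly A \<in> R" unfolding R_def by (rule range_eqI[of _ _ "[:0, 1:]"]) (simp add: pcompose_pCons)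
  have R01: "0 \<in> R" "1 \<in> R" using closed(1,2)[OF A_R A_R] by auto
  have "- 1 \<in> R" using closed(3)[OF R01(2,2)] by blast
  then have "fps_of_poly A - 1 \<in> R" using closed(3)[OF A_R, of "- 1"] by simp
  then have f_R: "coeff f k \<in> R" for k
    using A_R R01 closed(3) n(1) by (auto simp: f_def coeff_pCons split: nat.splits)
  \<comment> \<open>Reversing coefficients turns the factors \<open>X - y e\<close> into
    \<open>1 - y e * X\<close>, the form used for Newton's identities.\<close>
  have "(\<Prod>e\<in>I. [:1, - y e:]) = reflect_poly f"
  proof -
    have "y e \<noteq> 0" if "e \<in> I" for e
      using y(1)[OF that] by (cases "e = 0") (auto simp: y_def)
    then show ?thesis
      unfolding f_prod reflect_poly_prod by (intro prod.cong) (auto simp: reflect_poly_pCons' monom_Suc monom_0)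
  qed
  then have "coeff (\<Prod>e\<in>I. [:1, - y e:]) k \<in> R" for k
    using f_R R01 by (simp add: coeff_reflect_poly)
  then have "of_nat n * fps_X ^ m \<in> R"
    using power_sum_in_subring[OF I(1) R01(1) closed(3) R01(2), of y m] m(1) sum_y by simp
  then obtain Q where "fps_of_poly (monom (of_nat n) m) = fps_of_poly (pcompose Q A)"
    by (auto simp: R_def fps_of_poly_monom fps_of_nat)
  then have "monom (of_nat n) m = pcompose Q A" by (simp add: fps_of_poly_eq_iff)
  \<comment> \<open>\<open>u $ 0\<close> is a root of unity of order dividing \<open>n - 1\<close>
    and differs from \<open>1\<close>, so \<open>A\<close> takes the value
    \<open>(1 - z ^ n) / (1 - z) = 1\<close> at \<open>z = u $ 0\<close>.\<close>
  moreover have "poly A 0 = poly A (u $ 0)"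
  proof -
    have "(u $ 0) ^ (n - 1) = 1"
      using fps_tri_root_nth_0[of n 1 fps_X u] u n(1) by simp
    then have "(u $ 0) ^ n = u $ 0"
      using power_minus_mult[of n "u $ 0"] n(1) by simp
    then have "(1 - u $ 0) * poly A (u $ 0) = 1 - u $ 0"
      using one_diff_power_eq[of "u $ 0" n] by (simp add: A_def poly_sum poly_monom)
    moreover have "poly A 0 = 1"
      using n(1) by (simp add: A_def poly_sum poly_monom power_0_left sum.delta)
    ultimately show ?thesis using u(3) by simp
  qed
  ultimately show False
    using monom_not_pcompose n(2) m(1) u(2) by blast
qed

section \<open>Power series solutions of the Newton equations\<close>

lemma ex_root_of_unity_ne_1:
  assumes "of_nat r \<noteq> (0 :: 'a::alg_closed_field)" "1 < r"
  shows "\<exists>e :: 'a. e ^ r = 1 \<and> e \<noteq> 1"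
proof (rule ccontr)
  assume "\<not> ?thesis"
  then have "{e :: 'a. e ^ r = 1} = {1}" by auto
  then show False using card_roots_of_unity[OF assms(1)] assms(2) by simp
qed

lemma fps_newton_solutions:
  fixes u v :: "'a::alg_closed_field fps"
  assumes abc: "c < b" "b < a" "0 < c" "Gcd {a, b, c} = 1"
    and char: "of_nat (a - c) \<noteq> (0 :: 'a)" "of_nat (b - c) \<noteq> (0 :: 'a)" "of_nat (a - b) \<noteq> (0 :: 'a)"
    and u: "tri_root (a - c) (b - c) fps_X u" and v: "tri_root (a - c) (b - c) fps_X v"
    and eq: "\<And>m. m \<in> {a, b, c} \<Longrightarrow> 1 + fps_X ^ m = u ^ m + v ^ m"
  shows "u = 1 \<and> v = fps_X \<or> u = fps_X \<and> v = 1"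
proof -
  define n r where "n = a - c" and "r = b - c"
  have nr: "0 < r" "r < n" "a - b = n - r" using abc by (auto simp: n_def r_def)
  note u = u[folded n_def r_def] and v = v[folded n_def r_def]
  note char = char(1)[folded n_def] char(2)[folded r_def] char(3)[unfolded nr]
  have pos: "0 < m" if "m \<in> {a, b, c}" for m using that abc by auto
  have eq0: "(w $ 0) ^ m + (w' $ 0) ^ m = 1" if "m \<in> {a, b, c}" "1 + fps_X ^ m = w ^ m + w' ^ m" for m and w w' :: "'a fps"
    using arg_cong[OF that(2), of "\<lambda>f. f $ 0"] pos[OF that(1)] by (simp add: fps_power_zeroth zero_power)
  \<comment> \<open>If \<open>w\<close> is small, constant terms give \<open>w' $ 0 = 1\<close>. The
    series \<open>1\<close> is the big root with that constant term, so
    \<open>w' = 1\<close>.\<close>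
  have one_small: "w' = 1 \<and> w = fps_X"
    if w: "w $ 0 = 0" "tri_root n r fps_X w'" "\<And>m. m \<in> {a, b, c} \<Longrightarrow> 1 + fps_X ^ m = w ^ m + w' ^ m" for w w' :: "'a fps"
  proof -
    have "(w' $ 0) ^ m = 1 ^ m" if "m \<in> {a, b, c}" for m
      using eq0[OF that w(3)[OF that]] w(1) pos[OF that] by (simp add: zero_power)
    then have "w' $ 0 = 1" by (rule coprime_powers_eq[OF abc(4)]) simp_all
    then have "w' = 1"
      using fps_big_tri_root(2)[OF _ nr(1,2) char(3) w(2) tri_root_one] by simp
    then have "w ^ m = fps_X ^ m" if "m \<in> {a, b, c}" for m
      using w(3)[OF that] by simp
    then have "w = fps_X" by (rule coprime_powers_eq[OF abc(4)]) simp_all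
    with \<open>w' = 1\<close> show ?thesis by simp
  qed
  consider "u $ 0 = 0" | "v $ 0 = 0" | "u $ 0 \<noteq> 0" "v $ 0 \<noteq> 0" by blast
  then show ?thesis
  proof cases
    case 1
    then show ?thesis using one_small[of u v] v eq by blast
  next
    case 2
    then show ?thesis using one_small[of v u] u eq by (metis add.commute)
  next
    case 3
    show ?thesis
    proof (cases "r = 1")
      case False
      then obtain e :: 'a where e: "e ^ r = 1" "e \<noteq> 1"
        using ex_root_of_unity_ne_1[OF char(2)] nr(1) by auto
      obtain s where s: "s $ 0 = 0" "s $ 1 = e" "tri_root n r fps_X s"
        using fps_small_tri_root[OF nr(1,2) char(2) e(1)] by blast
      have X: "fps_X ^ r \<noteq> (1 :: 'a fps)"
        using nr(1) by (metis fps_X_power_nth fps_one_nth not_gr_zero zero_neq_one)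
      \<comment> \<open>\<open>s\<close> and \<open>fps_X\<close> belong to the same trinomial, so
        \<open>w\<close> and \<open>w oo s\<close> are both roots for the parameter
        \<open>s\<close>, with equal nonzero constant terms.\<close>
      have fixed: "w oo s = w" if w: "tri_root n r fps_X w" "w $ 0 \<noteq> 0" for w :: "'a fps"
        using fps_big_tri_root(2)[OF s(1) nr(1,2) char(3) fps_tri_root_compose[OF w(1) s(1)] tri_root_trans[OF s(3) w(1) X]] w(2)
        by simp
      have "s ^ m = fps_X ^ m" if m: "m \<in> {a, b, c}" for m
      proof -
        have "(1 + fps_X ^ m) oo s = (u ^ m + v ^ m) oo s" by (simp only: eq[OF m])
        then have "1 + s ^ m = u ^ m + v ^ m"
          using s(1) fixed[OF u 3(1)] fixed[OF v 3(2)]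
          by (simp add: fps_compose_add_distrib flip: fps_compose_power)
        then show ?thesis using eq[OF m] by (metis add_left_cancel)
      qed
      then have "s = fps_X" by (rule coprime_powers_eq[OF abc(4)]) simp_all
      with s(2) e(2) show ?thesis by simp
    next
      case True
      have "u $ 0 \<noteq> 1"
      proof
        assume "u $ 0 = 1"
        then have "u = 1"
          using fps_big_tri_root(2)[OF _ nr(1,2) char(3) u tri_root_one] by simp
        then have "v ^ m = fps_X ^ m" if "m \<in> {a, b, c}" for m
          using eq[OF that] by simp
        then have "v = fps_X" by (rule coprime_powers_eq[OF abc(4)]) simp_all
        with 3(2) show False by simp
      qed
      then have False
        using no_big_tri_roots[of n u v c] u v 3 nr char True abc(3) eq[of c] by simp
      then show ?thesis ..
    qed
  qed
qed

text \<open>The \<open>n - r\<close> big and \<open>r\<close> small series already exhaust the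
  degree \<open>n\<close>, so passing to a larger field adds no root.\<close>

lemma tri_root_in_range:
  fixes h :: "'a::alg_closed_field fps \<Rightarrow> 'b::field"
  assumes hom: "\<And>f g. h (f + g) = h f + h g" "\<And>f g. h (f * g) = h f * h g" "h 1 = 1" and "inj h"
    and nr: "0 < r" "r < n" and char: "of_nat r \<noteq> (0 :: 'a)" "of_nat (n - r) \<noteq> (0 :: 'a)"
    and u: "tri_root n r (h fps_X) u"
  shows "\<exists>f. u = h f \<and> tri_root n r fps_X f"
proof (rule ccontr)
  assume no_root: "\<not> ?thesis"
  have h_minus: "h (f - g) = h f - h g" for f g
    using hom(1)[of "f - g" g] by (simp add: algebra_simps)
  have h_power: "h (f ^ k) = h f ^ k" for f k
    by (induction k) (simp_all add: hom)
  have h_root: "tri_root n r (h fps_X) (h f)" if "tri_root n r fps_X f" for f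
    using arg_cong[OF that[unfolded tri_root_def], of h] by (simp add: tri_root_def hom h_minus h_power)
  define B C where "B = {e :: 'a. e ^ (n - r) = 1}" and "C = {e :: 'a. e ^ r = 1}"
  have card_BC: "card B = n - r" "card C = r"
    unfolding B_def C_def using char by (auto intro: card_roots_of_unity)
  then have fin_BC: "finite B" "finite C"
    using nr by (auto intro!: card_ge_0_finite)
  have "\<forall>e. \<exists>f. e \<in> B \<longrightarrow> f $ 0 = e \<and> tri_root n r (fps_X :: 'a fps) f"
    using fps_big_tri_root(1)[of "fps_X :: 'a fps" r n] nr char by (auto simp: B_def)
  from choice[OF this] obtain x where x: "\<And>e. e \<in> B \<Longrightarrow> x e $ 0 = e \<and> tri_root n r fps_X (x e)" by blast
  have "\<forall>e. \<exists>f. e \<in> C \<longrightarrow> f $ 0 = 0 \<and> f $ 1 = e \<and> tri_root n r (fps_X :: 'a fps) f"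
    using fps_small_tri_root[of r n] nr char by (auto simp: C_def)
  from choice[OF this] obtain y
    where y: "\<And>e. e \<in> C \<Longrightarrow> y e $ 0 = 0 \<and> y e $ 1 = e \<and> tri_root n r fps_X (y e)" by blast
  have "0 \<notin> B" using nr by (auto simp: B_def zero_power)
  have x0: "x e $ 0 = e" if "e \<in> B" for e using x[OF that] by blast
  have y0: "y e $ 0 = 0" and y1: "y e $ 1 = e" if "e \<in> C" for e using y[OF that] by blast+
  have disj: "x ` B \<inter> y ` C = {}"
  proof (rule equals0I, elim IntE imageE)
    fix f e e' assume *: "f = x e" "e \<in> B" "f = y e'" "e' \<in> C"
    have "e = f $ 0" using x0[OF *(2)] *(1) by metis
    also have "\<dots> = 0" unfolding *(3) by (rule y0[OF *(4)])
    finally show False using \<open>0 \<notin> B\<close> *(2) by metis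
  qed
  have inj: "inj_on x B" "inj_on y C"
    by (rule inj_on_inverseI[of _ "\<lambda>f. f $ 0"], erule x0)
      (rule inj_on_inverseI[of _ "\<lambda>f. f $ 1"], erule y1)
  define g where "g = monom (1 - h fps_X ^ r) n - monom (1 - h fps_X ^ n) r + [:h fps_X ^ r - h fps_X ^ n:]"
  have poly_g: "poly g z = (1 - h fps_X ^ r) * (z ^ n - 1) - (1 - h fps_X ^ n) * (z ^ r - 1)" for z
    by (simp add: g_def poly_monom algebra_simps)
  have "coeff g n = 1 - h fps_X ^ r"
    using nr by (simp add: g_def coeff_pCons split: nat.split)
  moreover have "h (fps_X ^ r) \<noteq> h 1"
    using \<open>inj h\<close> nr(1) by (metis fps_X_power_nth fps_one_nth inj_eq not_gr_zero zero_neq_one)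
  ultimately have "coeff g n \<noteq> 0" by (simp add: h_power hom)
  then have "g \<noteq> 0" by auto
  have "degree g \<le> n"
    unfolding g_def using nr
    by (intro degree_add_le degree_diff_le) (auto intro: order.trans[OF degree_monom_le])
  define S where "S = insert u (h ` (x ` B \<union> y ` C))"
  have "u \<notin> h ` (x ` B \<union> y ` C)" using no_root x y by blast
  then have "card S = Suc (card (h ` (x ` B \<union> y ` C)))"
    using fin_BC by (simp add: S_def)
  also have "card (h ` (x ` B \<union> y ` C)) = card (x ` B \<union> y ` C)"
    using \<open>inj h\<close> by (intro card_image) (auto intro: inj_on_subset)
  also have "\<dots> = n"
    using disj inj fin_BC card_BC nr by (simp add: card_Un_disjoint card_image)
  finally have "card S = Suc n" .
  moreover have "S \<subseteq> {z. poly g z = 0}"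
    using u x y h_root by (auto simp: S_def poly_g tri_root_def)
  then have "card S \<le> card {z. poly g z = 0}"
    by (rule card_mono[OF poly_roots_finite[OF \<open>g \<noteq> 0\<close>]])
  ultimately show False
    using card_poly_roots_bound[OF \<open>g \<noteq> 0\<close>] \<open>degree g \<le> n\<close> by simp
qed

section \<open>Polynomials over a subfield\<close>

lemma subfield_minus: "is_subfield K \<Longrightarrow> u \<in> K \<Longrightarrow> v \<in> K \<Longrightarrow> u - v \<in> K"
  unfolding is_subfield_def by (metis diff_conv_add_uminus)

lemma subfield_divide: "is_subfield K \<Longrightarrow> u \<in> K \<Longrightarrow> v \<in> K \<Longrightarrow> u / v \<in> K"
  unfolding is_subfield_def by (metis field_class.field_divide_inverse)

lemma subfield_power: "is_subfield K \<Longrightarrow> u \<in> K \<Longrightarrow> u ^ n \<in> K"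
  by (induction n) (auto simp: is_subfield_def)

lemma subfield_of_nat: "is_subfield K \<Longrightarrow> of_nat n \<in> K"
  by (induction n) (auto simp: is_subfield_def)

lemma subfield_sum: "is_subfield K \<Longrightarrow> (\<And>i. i \<in> I \<Longrightarrow> f i \<in> K) \<Longrightarrow> sum f I \<in> K"
  by (induction I rule: infinite_finite_induct) (auto simp: is_subfield_def)

lemma subfield_power_gcd:
  assumes "is_subfield K" "x ^ i \<in> K" "x ^ j \<in> K" "x \<noteq> 0"
  shows "x ^ gcd i j \<in> K"
  using assms(2,3)
proof (induction i j rule: gcd_nat_induct)
  case (step m n)
  have "x ^ m = (x ^ n) ^ (m div n) * x ^ (m mod n)"
    by (simp flip: power_mult power_add)
  then have "x ^ (m mod n) = x ^ m / (x ^ n) ^ (m div n)"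
    using assms(4) by simp
  then have "x ^ (m mod n) \<in> K"
    using step.prems assms(1) by (simp add: subfield_divide subfield_power)
  then show ?case using step.IH step.prems(2) by (simp add: gcd_red_nat[of m n])
qed simp

lemma subfield_coprime_powers:
  assumes "is_subfield K" "Gcd {a, b, c} = 1" "\<And>m. m \<in> {a, b, c} \<Longrightarrow> x ^ m \<in> K" "x \<noteq> 0"
  shows "x \<in> K"
proof -
  have "x ^ gcd a (gcd b c) \<in> K"
    by (intro subfield_power_gcd assms) auto
  then show ?thesis using assms(2) by simp
qed

text \<open>Subfields are sets rather than types, so polynomials over \<open>K\<close> are kept
  inside the polynomial ring of the ambient field.\<close>

definition polys_over :: "'a::field set \<Rightarrow> 'a poly set" where
  "polys_over K = {P. \<forall>i. coeff P i \<in> K}"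

context
  fixes K :: "'a::field set"
  assumes K: "is_subfield K"
begin

lemma polys_over_0 [simp]: "0 \<in> polys_over K"
  using K by (simp add: polys_over_def is_subfield_def)

lemma polys_over_pCons [simp]: "pCons a P \<in> polys_over K \<longleftrightarrow> a \<in> K \<and> P \<in> polys_over K"
  by (force simp: polys_over_def coeff_pCons split: nat.splits)

lemma polys_over_add: "P \<in> polys_over K \<Longrightarrow> Q \<in> polys_over K \<Longrightarrow> P + Q \<in> polys_over K"
  using K by (simp add: polys_over_def is_subfield_def)

lemma polys_over_diff: "P \<in> polys_over K \<Longrightarrow> Q \<in> polys_over K \<Longrightarrow> P - Q \<in> polys_over K"
  using K by (simp add: polys_over_def subfield_minus)

lemma polys_over_mult: "P \<in> polys_over K \<Longrightarrow> Q \<in> polys_over K \<Longrightarrow> P * Q \<in> polys_over K"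
  using K by (auto simp: polys_over_def coeff_mult is_subfield_def intro!: subfield_sum[OF K])

lemma polys_over_1: "1 \<in> polys_over K"
  using K by (simp add: one_pCons is_subfield_def)

lemma polys_over_power: "P \<in> polys_over K \<Longrightarrow> P ^ n \<in> polys_over K"
  by (induction n) (auto intro: polys_over_mult polys_over_1)

lemma polys_over_smult: "a \<in> K \<Longrightarrow> P \<in> polys_over K \<Longrightarrow> smult a P \<in> polys_over K"
  using K by (simp add: polys_over_def is_subfield_def)

lemma polys_over_pderiv: "P \<in> polys_over K \<Longrightarrow> pderiv P \<in> polys_over K"
  using K subfield_of_nat[OF K] by (simp add: polys_over_def coeff_pderiv is_subfield_def del: of_nat_Suc)

text \<open>Long division, one coefficient at a time: prepending a coefficient to the remainder
  raises its degree to at most \<open>degree m\<close>, and a single multiple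
  \<open>smult e m\<close> with \<open>e\<close> in \<open>K\<close> restores the bound.\<close>

lemma polys_over_divmod:
  assumes m: "m \<in> polys_over K" "m \<noteq> 0" and "P \<in> polys_over K"
  shows "\<exists>q\<in>polys_over K. P - m * q \<in> polys_over K \<and> (P - m * q = 0 \<or> degree (P - m * q) < degree m)"
  using assms(3)
proof (induction P)
  case 0
  then show ?case by (intro bexI[of _ 0]) simp_all
next
  case (pCons a P)
  then obtain q where q: "q \<in> polys_over K" "P - m * q \<in> polys_over K"
    and deg: "P - m * q = 0 \<or> degree (P - m * q) < degree m"
    by auto
  define R where "R = pCons a (P - m * q)"
  define e where "e = coeff R (degree m) / lead_coeff m"
  have R: "R \<in> polys_over K" using pCons.prems q by (simp add: R_def)
  have e: "e \<in> K"
    using R m(1) K by (simp add: e_def polys_over_def subfield_divide)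
  have "degree R \<le> degree m"
    using deg by (auto simp: R_def degree_pCons_eq_if)
  then have "degree (R - smult e m) \<le> degree m"
    by (intro degree_diff_le) simp_all
  moreover have "coeff (R - smult e m) (degree m) = 0"
    using m(2) by (simp add: e_def)
  ultimately have "R - smult e m = 0 \<or> degree (R - smult e m) < degree m"
    by (metis le_neq_implies_less leading_coeff_0_iff)
  moreover have "pCons a P - m * (pCons 0 q + [:e:]) = R - smult e m"
    by (simp add: R_def algebra_simps)
  moreover have "R - smult e m \<in> polys_over K"
    by (intro polys_over_diff R polys_over_smult e m)
  moreover have "pCons 0 q + [:e:] \<in> polys_over K"
    using q(1) e K by (intro polys_over_add) (simp_all add: is_subfield_def)
  ultimately show ?case by metis
qed

lemma polys_over_principal:
  assumes J: "J \<subseteq> polys_over K" "\<And>P Q. P \<in> J \<Longrightarrow> Q \<in> J \<Longrightarrow> P - Q \<in> J"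
    "\<And>P Q. P \<in> J \<Longrightarrow> Q \<in> polys_over K \<Longrightarrow> P * Q \<in> J" and "P0 \<in> J" "P0 \<noteq> 0"
  shows "\<exists>m\<in>J. m \<noteq> 0 \<and> (\<forall>P\<in>J. \<exists>q\<in>polys_over K. P = m * q)"
proof -
  obtain m where m: "m \<in> J" "m \<noteq> 0" and least: "\<And>P. P \<in> J \<Longrightarrow> P \<noteq> 0 \<Longrightarrow> degree m \<le> degree P"
    using ex_has_least_nat[of "\<lambda>P. P \<in> J \<and> P \<noteq> 0" P0 degree] assms(4,5) by blast
  have "\<exists>q\<in>polys_over K. P = m * q" if P: "P \<in> J" for P
  proof -
    obtain q where q: "q \<in> polys_over K" "P - m * q = 0 \<or> degree (P - m * q) < degree m"
      using polys_over_divmod[of m P] m P J(1) by blast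
    have "P - m * q \<in> J" using J(2,3) P m(1) q(1) by blast
    with q(2) least have "P - m * q = 0" by (metis not_le)
    with q(1) show ?thesis by auto
  qed
  with m show ?thesis by blast
qed

text \<open>A generator of the ideal of relations of \<open>t\<close> over \<open>K\<close>, not
  normalised to be monic.\<close>

definition is_minpoly :: "'a \<Rightarrow> 'a poly \<Rightarrow> bool" where
  "is_minpoly t m \<longleftrightarrow> m \<in> polys_over K \<and> m \<noteq> 0 \<and> poly m t = 0 \<and>
     (\<forall>P\<in>polys_over K. poly P t = 0 \<longrightarrow> (\<exists>q\<in>polys_over K. P = m * q))"

lemma minpoly_exists:
  assumes "P0 \<in> polys_over K" "P0 \<noteq> 0" "poly P0 t = 0"
  shows "\<exists>m. is_minpoly t m"
  using polys_over_principal[of "{P \<in> polys_over K. poly P t = 0}" P0] assms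
  unfolding is_minpoly_def by (auto simp: polys_over_diff polys_over_mult)

text \<open>Irreducibility in the form used later: otherwise the cofactor \<open>q\<close> would
  vanish at \<open>t\<close> and be a multiple of \<open>m\<close>, although its degree is
  smaller.\<close>

lemma minpoly_factor:
  assumes m: "is_minpoly t m" and d: "m = d * q" "d \<in> polys_over K" "q \<in> polys_over K" "degree d \<noteq> 0"
  shows "poly d t = 0"
proof (rule ccontr)
  assume "poly d t \<noteq> 0"
  then have "poly q t = 0" using m d(1) by (auto simp: is_minpoly_def)
  then obtain s where "q = m * s" using m d(3) by (auto simp: is_minpoly_def)
  moreover have "q \<noteq> 0" "m \<noteq> 0" "d \<noteq> 0" using m d(1) by (auto simp: is_minpoly_def)
  ultimately have "degree q \<ge> degree m" by (auto simp: degree_mult_eq)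
  then show False using d(1,4) \<open>q \<noteq> 0\<close> \<open>d \<noteq> 0\<close> by (simp add: degree_mult_eq)
qed

text \<open>Bezout: a generator \<open>d\<close> of the ideal spanned by \<open>m\<close> and
  \<open>H\<close> divides \<open>m\<close> but does not vanish at \<open>t\<close>, so it is a
  constant. Evaluating \<open>d = m * A + H * C\<close> at \<open>t\<close> inverts
  \<open>poly H t\<close>.\<close>

lemma minpoly_inverse:
  assumes m: "is_minpoly t m" and H: "H \<in> polys_over K" "poly H t \<noteq> 0"
  shows "\<exists>G\<in>polys_over K. poly G t = inverse (poly H t)"
proof -
  define J where "J = {m * A + H * C |A C. A \<in> polys_over K \<and> C \<in> polys_over K}"
  note [intro] = polys_over_add polys_over_diff polys_over_mult
  have mK: "m \<in> polys_over K" using m by (simp add: is_minpoly_def)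
  have "J \<subseteq> polys_over K" using mK H(1) by (auto simp: J_def)
  moreover have "P - Q \<in> J" if PQ: "P \<in> J" "Q \<in> J" for P Q
  proof -
    obtain A C A' C' where "P = m * A + H * C" "Q = m * A' + H * C'" and
      *: "A \<in> polys_over K" "C \<in> polys_over K" "A' \<in> polys_over K" "C' \<in> polys_over K"
      using PQ unfolding J_def by blast
    then have "P - Q = m * (A - A') + H * (C - C')" by (simp add: algebra_simps)
    then show ?thesis using * unfolding J_def by blast
  qed
  moreover have "P * Q \<in> J" if PQ: "P \<in> J" "Q \<in> polys_over K" for P Q
  proof -
    obtain A C where "P = m * A + H * C" and *: "A \<in> polys_over K" "C \<in> polys_over K"
      using PQ unfolding J_def by blast
    then have "P * Q = m * (A * Q) + H * (C * Q)" by (simp add: algebra_simps)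
    then show ?thesis using * PQ unfolding J_def by blast
  qed
  moreover have "m = m * 1 + H * 0" "H = m * 0 + H * 1" by simp_all
  then have mH: "m \<in> J" "H \<in> J"
    unfolding J_def using polys_over_0 polys_over_1 by blast+
  moreover have "m \<noteq> 0" using m by (simp add: is_minpoly_def)
  ultimately obtain d where d: "d \<in> J" "d \<noteq> 0" and gen: "\<And>P. P \<in> J \<Longrightarrow> \<exists>q\<in>polys_over K. P = d * q"
    using polys_over_principal[of J m] by metis
  have dK: "d \<in> polys_over K" using d(1) \<open>J \<subseteq> polys_over K\<close> by blast
  have "poly d t \<noteq> 0" using gen[OF mH(2)] H(2) by auto
  then have "degree d = 0" using gen[OF mH(1)] minpoly_factor[OF m] dK by blast
  then obtain e where e: "d = [:e:]" by (metis degree_0_id)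
  obtain A C where AC: "d = m * A + H * C" "C \<in> polys_over K" using d(1) by (auto simp: J_def)
  have "e = poly H t * poly C t"
    using m arg_cong[OF AC(1), of "\<lambda>P. poly P t"] by (simp add: e is_minpoly_def)
  moreover have "e \<noteq> 0" "e \<in> K" using e d(2) dK by auto
  ultimately have "poly (smult (inverse e) C) t = inverse (poly H t)"
    using H(2) by (simp add: field_simps)
  moreover have "smult (inverse e) C \<in> polys_over K"
    using AC(2) \<open>e \<in> K\<close> K by (intro polys_over_smult) (auto simp: is_subfield_def)
  ultimately show ?thesis by blast
qed

lemma subfield_simple_extension:
  assumes m: "is_minpoly t m"
  shows "is_subfield ((\<lambda>P. poly P t) ` polys_over K)"
    and "K \<subseteq> (\<lambda>P. poly P t) ` polys_over K" and "t \<in> (\<lambda>P. poly P t) ` polys_over K"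
proof -
  let ?W = "(\<lambda>P. poly P t) ` polys_over K"
  show sub: "K \<subseteq> ?W"
  proof
    fix u assume "u \<in> K"
    then show "u \<in> ?W" by (intro image_eqI[of _ _ "[:u:]"]) simp_all
  qed
  show "t \<in> ?W" using K by (intro image_eqI[of _ _ "[:0, 1:]"]) (simp_all add: is_subfield_def)
  have "0 \<in> ?W" "1 \<in> ?W" using sub K by (auto simp: is_subfield_def)
  moreover have "poly P t + poly Q t \<in> ?W" "poly P t * poly Q t \<in> ?W"
    if "P \<in> polys_over K" "Q \<in> polys_over K" for P Q
    using that polys_over_add[of P Q] polys_over_mult[of P Q] by (metis image_eqI poly_add, metis image_eqI poly_mult)
  moreover have "- poly P t \<in> ?W" if "P \<in> polys_over K" for P
    using polys_over_diff[OF polys_over_0 that] by (intro image_eqI[of _ _ "0 - P"]) simp_all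
  moreover have "inverse (poly P t) \<in> ?W" if "P \<in> polys_over K" for P
    using minpoly_inverse[OF m that] \<open>0 \<in> ?W\<close> by (cases "poly P t = 0") (simp, metis image_eqI)
  ultimately show "is_subfield ?W" unfolding is_subfield_def by blast
qed

end

section \<open>Homomorphisms and derivations\<close>

context
  fixes h :: "'a::field \<Rightarrow> 'b::field"
  assumes h: "\<And>x y. h (x + y) = h x + h y" "\<And>x y. h (x * y) = h x * h y" "h 1 = 1"
begin

lemma field_hom_0: "h 0 = 0"
  using h(1)[of 0 0] by (metis add.right_neutral add_left_cancel)

lemma field_hom_diff: "h (x - y) = h x - h y"
  using h(1)[of "x - y" y] by simp

lemma field_hom_power: "h (x ^ n) = h x ^ n"
  by (induction n) (simp_all add: h)

lemma field_hom_of_nat: "h (of_nat n) = of_nat n"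
  by (induction n) (simp_all add: h field_hom_0)

lemma field_hom_sum: "h (sum f I) = (\<Sum>i\<in>I. h (f i))"
  by (induction I rule: infinite_finite_induct) (simp_all add: h field_hom_0)

lemma field_hom_eq_0_iff: "h x = 0 \<longleftrightarrow> x = 0"
  using h(2)[of x "inverse x"] h(3) field_hom_0 by (cases "x = 0") auto

lemma field_hom_inverse: "h (inverse x) = inverse (h x)"
proof (cases "x = 0")
  case False
  then have "h x * h (inverse x) = 1" using h(2)[of x "inverse x"] h(3) by simp
  then show ?thesis by (simp add: inverse_unique)
qed (simp add: field_hom_0)

lemma field_hom_inj: "h x = h y \<longleftrightarrow> x = y"
  using field_hom_eq_0_iff[of "x - y"] by (simp add: field_hom_diff)

lemma map_poly_hom_add: "map_poly h (P + Q) = map_poly h P + map_poly h Q"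
  by (rule poly_eqI) (simp add: coeff_map_poly field_hom_0 h)

lemma map_poly_hom_diff: "map_poly h (P - Q) = map_poly h P - map_poly h Q"
  by (rule poly_eqI) (simp add: coeff_map_poly field_hom_0 field_hom_diff)

lemma map_poly_hom_mult: "map_poly h (P * Q) = map_poly h P * map_poly h Q"
  by (rule poly_eqI) (simp add: coeff_map_poly field_hom_0 coeff_mult field_hom_sum h)

lemma map_poly_hom_power: "map_poly h (P ^ n) = map_poly h P ^ n"
  by (induction n) (simp_all add: map_poly_hom_mult h)

lemma pderiv_map_poly_hom: "pderiv (map_poly h P) = map_poly h (pderiv P)"
  by (rule poly_eqI) (simp add: coeff_map_poly coeff_pderiv field_hom_0 h field_hom_of_nat del: of_nat_Suc)

lemma poly_map_poly_hom: "poly (map_poly h P) (h x) = h (poly P x)"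
  by (induction P) (simp_all add: map_poly_pCons field_hom_0 h)

lemma degree_map_poly_hom: "degree (map_poly h P) = degree P"
  by (rule degree_map_poly) (simp add: field_hom_eq_0_iff)

text \<open>The relations of \<open>t'\<close> have a generator \<open>d\<close>, a nonconstant
  factor of \<open>m\<close>, so \<open>d\<close> also vanishes at \<open>t\<close>. Equality of the
  two kernels replaces an explicit embedding of \<open>K(t)\<close> sending \<open>t\<close> to
  \<open>t'\<close>.\<close>

lemma minpoly_conjugate:
  assumes K: "is_subfield K" and m: "is_minpoly K t m" and t': "poly (map_poly h m) t' = 0"
    and H: "H \<in> polys_over K"
  shows "poly (map_poly h H) t' = 0 \<longleftrightarrow> poly H t = 0"
proof
  assume "poly H t = 0"
  then obtain q where "H = m * q" using m H unfolding is_minpoly_def[OF K] by blast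
  then show "poly (map_poly h H) t' = 0" using t' by (simp add: map_poly_hom_mult)
next
  assume H0: "poly (map_poly h H) t' = 0"
  define J where "J = {P \<in> polys_over K. poly (map_poly h P) t' = 0}"
  have mJ: "m \<in> J" "m \<noteq> 0" using m t' by (auto simp: J_def is_minpoly_def[OF K])
  then obtain d where d: "d \<in> J" "d \<noteq> 0" and gen: "\<And>P. P \<in> J \<Longrightarrow> \<exists>q\<in>polys_over K. P = d * q"
    using polys_over_principal[OF K, of J m] polys_over_diff[OF K] polys_over_mult[OF K]
    by (auto simp: J_def map_poly_hom_diff map_poly_hom_mult)
  have "degree d \<noteq> 0"
  proof
    assume "degree d = 0"
    then obtain e where "d = [:e:]" by (metis degree_0_id)
    then show False using d by (simp add: J_def map_poly_pCons field_hom_0 field_hom_eq_0_iff)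
  qed
  then have "poly d t = 0"
    using minpoly_factor[OF K m] gen[OF mJ(1)] d(1) by (auto simp: J_def)
  then show "poly H t = 0" using gen[of H] H H0 by (auto simp: J_def)
qed

text \<open>
  For simple \<open>t'\<close>, a derivation of the base field lifts along evaluation at \<open>t'\<close> in such a way that it
  kills \<open>m\<close>, hence all multiples of \<open>m\<close>.
\<close>

lemma derivation_extends:
  fixes \<delta> :: "'a \<Rightarrow> 'a"
  assumes \<delta>: "\<And>x y. \<delta> (x + y) = \<delta> x + \<delta> y" "\<And>x y. \<delta> (x * y) = \<delta> x * y + x * \<delta> y"
    and simple: "poly (map_poly h (pderiv m)) t' \<noteq> 0"
  shows "\<exists>D :: 'a poly \<Rightarrow> 'b. (\<forall>P Q. D (P + Q) = D P + D Q) \<and>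
    (\<forall>P Q. D (P * Q) = D P * poly (map_poly h Q) t' + poly (map_poly h P) t' * D Q) \<and>
    (\<forall>f. D [:f:] = h (\<delta> f)) \<and> D m = 0"
proof -
  have \<delta>0: "\<delta> 0 = 0" using \<delta>(1)[of 0 0] by (metis add.right_neutral add_left_cancel)
  have \<delta>_sum: "\<delta> (sum f I) = (\<Sum>i\<in>I. \<delta> (f i))" for f and I :: "nat set"
    by (induction I rule: infinite_finite_induct) (simp_all add: \<delta> \<delta>0)
  have add: "map_poly \<delta> (P + Q) = map_poly \<delta> P + map_poly \<delta> Q" for P Q
    by (rule poly_eqI) (simp add: coeff_map_poly \<delta>0 \<delta>)
  have mult: "map_poly \<delta> (P * Q) = map_poly \<delta> P * Q + P * map_poly \<delta> Q" for P Q
    by (rule poly_eqI) (simp add: coeff_map_poly \<delta>0 coeff_mult \<delta>_sum \<delta> sum.distrib)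
  \<comment> \<open>The value of \<open>D\<close> on the polynomial variable, forced by the demand
    \<open>D m = 0\<close>.\<close>
  define \<tau> where "\<tau> = - poly (map_poly h (map_poly \<delta> m)) t' / poly (map_poly h (pderiv m)) t'"
  define D where "D = (\<lambda>P. poly (map_poly h (map_poly \<delta> P)) t' + poly (map_poly h (pderiv P)) t' * \<tau>)"
  have "D (P + Q) = D P + D Q" for P Q
    by (simp add: D_def add map_poly_hom_add pderiv_add algebra_simps)
  moreover have "D (P * Q) = D P * poly (map_poly h Q) t' + poly (map_poly h P) t' * D Q" for P Q
    by (simp add: D_def mult map_poly_hom_add map_poly_hom_mult pderiv_mult algebra_simps)
  moreover have "D [:f:] = h (\<delta> f)" for f
    by (simp add: D_def map_poly_pCons \<delta>0 field_hom_0 pderiv_pCons)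
  moreover have "D m = 0" using simple by (simp add: D_def \<tau>_def)
  ultimately show ?thesis by blast
qed

end

text \<open>The vectors \<open>1\<close>, \<open>t ^ k\<close>, \<open>u ^ k\<close> with
  \<open>k\<close> in \<open>{a, b, c}\<close> lie in the plane spanned by \<open>u ^ k\<close> and
  \<open>v ^ k\<close>. Their determinant therefore vanishes, and after removing
  \<open>u ^ c * t ^ c\<close> it is the trinomial relation.\<close>

lemma trinomial_relation:
  fixes u v t A B :: "'a::field"
  assumes abc: "c < b" "b < a" "0 < c" and "u \<noteq> 0" "t \<noteq> 0"
    and 1: "\<And>k. k \<in> {a, b, c} \<Longrightarrow> 1 = (1 - A) * u ^ k + (1 - B) * v ^ k"
    and t: "\<And>k. k \<in> {a, b, c} \<Longrightarrow> t ^ k = A * u ^ k + B * v ^ k"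
  shows "tri_root (a - c) (b - c) t u"
proof -
  have det: "ua * (tc * ob - tb * oc) + ub * (ta * oc - tc * oa) + uc * (tb * oa - ta * ob) = 0"
    if "oa = (1 - A) * ua + (1 - B) * va" "ob = (1 - A) * ub + (1 - B) * vb" "oc = (1 - A) * uc + (1 - B) * vc"
      "ta = A * ua + B * va" "tb = A * ub + B * vb" "tc = A * uc + B * vc"
    for oa ob oc ta tb tc ua ub uc va vb vc
    unfolding that by (simp add: algebra_simps)
  have pow: "z ^ a = z ^ c * z ^ (a - c)" "z ^ b = z ^ c * z ^ (b - c)" for z :: 'a
    using abc by (simp_all flip: power_add)
  have "u ^ a * (t ^ c * 1 - t ^ b * 1) + u ^ b * (t ^ a * 1 - t ^ c * 1) + u ^ c * (t ^ b * 1 - t ^ a * 1) = 0"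
    by (rule det[OF 1 1 1 t t t]) simp_all
  then have "u ^ c * t ^ c * ((1 - t ^ (b - c)) * (u ^ (a - c) - 1) - (1 - t ^ (a - c)) * (u ^ (b - c) - 1)) = 0"
    unfolding pow by (simp add: algebra_simps)
  then show ?thesis using assms(4,5) by (simp add: tri_root_def)
qed

section \<open>Conjugates of the ratio of the variables\<close>

text \<open>The coefficient of \<open>fls_X ^ b\<close> is \<open>a\<close> on the left and
  \<open>0\<close> on the right.\<close>

lemma fls_one_plus_power_neq:
  assumes "b < a" "0 < b" "of_nat a \<noteq> (0 :: 'a::field)"
  shows "(1 + fls_X ^ b) ^ a \<noteq> ((1 + fls_X ^ a) ^ b :: 'a fls)"
proof
  assume "(1 + fls_X ^ b) ^ a = ((1 + fls_X ^ a) ^ b :: 'a fls)"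
  then have "fps_to_fls ((1 + fps_X ^ b) ^ a) = (fps_to_fls ((1 + fps_X ^ a) ^ b) :: 'a fls)"
    by (simp add: fps_to_fls_power)
  then have eq: "(1 + fps_X ^ b) ^ a = ((1 + fps_X ^ a) ^ b :: 'a fps)" by simp
  obtain R :: "'a fps" where "poly (monom 1 a) (1 + fps_X ^ b) =
      poly (monom 1 a) 1 + fps_X ^ b * poly (pderiv (monom 1 a)) 1 + (fps_X ^ b)\<^sup>2 * R"
    using poly_taylor2 by blast
  then have R: "(1 + fps_X ^ b) ^ a = 1 + fps_X ^ b * (of_nat a + fps_X ^ b * R)"
    by (simp add: poly_monom pderiv_monom power2_eq_square algebra_simps)
  obtain S :: "'a fps" where "poly (monom 1 b) (1 + fps_X ^ a) =
      poly (monom 1 b) 1 + fps_X ^ a * poly (pderiv (monom 1 b)) 1 + (fps_X ^ a)\<^sup>2 * S"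
    using poly_taylor2 by blast
  then have S: "(1 + fps_X ^ a) ^ b = 1 + fps_X ^ a * (of_nat b + fps_X ^ a * S)"
    by (simp add: poly_monom pderiv_monom power2_eq_square algebra_simps)
  have "(1 + fps_X ^ b * (of_nat a + fps_X ^ b * R)) $ b = (1 + fps_X ^ a * (of_nat b + fps_X ^ a * S)) $ b"
    using eq R S by simp
  then have "(of_nat a :: 'a) = 0"
    using assms(1,2) by (simp add: fps_X_power_mult_nth)
  with assms(3) show False by simp
qed

lemma fls_X_power_inj: "fls_X ^ i = (fls_X ^ j :: 'a::field fls) \<longleftrightarrow> i = j"
proof
  assume "fls_X ^ i = (fls_X ^ j :: 'a fls)"
  then have "fps_to_fls (fps_X ^ i) = (fps_to_fls (fps_X ^ j) :: 'a fls)"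
    by (simp add: fps_to_fls_power)
  then have "(fps_X ^ i :: 'a fps) $ i = fps_X ^ j $ i" by simp
  then show "i = j" by (simp split: if_splits)
qed simp

lemma fls_one_plus_X_power_nonzero:
  assumes "0 < k"
  shows "1 + fls_X ^ k \<noteq> (0 :: 'a::field fls)"
proof
  assume "1 + fls_X ^ k = (0 :: 'a fls)"
  then have "fps_to_fls (1 + fps_X ^ k) = (fps_to_fls 0 :: 'a fls)"
    by (simp add: fps_to_fls_power)
  then have "(1 + fps_X ^ k :: 'a fps) $ 0 = 0" by (simp only: fps_to_fls_eq_iff fps_zero_nth)
  then show False using assms by simp
qed

text \<open>The core argument, carried out in Laurent series in \<open>t\<close> with
  \<open>x\<close> a nonzero constant: there \<open>d/dt\<close> is available as
  \<open>fls_deriv\<close>, and roots of the trinomial can be compared as power series.\<close>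

lemma fls_symmetric_in_subfield:
  fixes K :: "'a::alg_closed_field fls set" and x0 :: 'a
  assumes abc: "c < b" "b < a" "0 < c" "Gcd {a, b, c} = 1"
    and char: "of_nat a \<noteq> (0 :: 'a)" "of_nat b \<noteq> (0 :: 'a)" "of_nat c \<noteq> (0 :: 'a)"
      "of_nat (a - c) \<noteq> (0 :: 'a)" "of_nat (b - c) \<noteq> (0 :: 'a)" "of_nat (a - b) \<noteq> (0 :: 'a)"
    and x0: "x0 \<noteq> 0" and K: "is_subfield K"
    and N: "\<And>k. k \<in> {a, b, c} \<Longrightarrow> fls_const x0 ^ k * (1 + fls_X ^ k) \<in> K"
  shows "fls_X + inverse fls_X \<in> K"
proof -
  define x t :: "'a fls" where "x = fls_const x0" and "t = fls_X"
  have xt: "x \<noteq> 0" "t \<noteq> 0" using x0 by (simp_all add: x_def t_def)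
  define N where "N k = x ^ k * (1 + t ^ k)" for k
  have NK: "N k \<in> K" if "k \<in> {a, b, c}" for k using assms(13)[OF that] by (simp add: N_def x_def t_def)
  have pos: "0 < k" if "k \<in> {a, b, c}" for k using that abc by auto
  have t_inj: "t ^ i = t ^ j \<longleftrightarrow> i = j" for i j by (simp add: t_def fls_X_power_inj)
  have one_t: "1 + t ^ k \<noteq> 0" if "k > 0" for k
    using fls_one_plus_X_power_nonzero[OF that] by (simp add: t_def)
  note po = polys_over_add[OF K] polys_over_diff[OF K] polys_over_mult[OF K] polys_over_power[OF K]
    polys_over_1[OF K] polys_over_pCons[OF K] polys_over_0[OF K]

  \<comment> \<open>Eliminating \<open>x\<close> from \<open>N a\<close> and \<open>N b\<close>
    shows that \<open>t\<close> is algebraic over \<open>K\<close>.\<close>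
  define P0 where "P0 = (1 + [:0, 1:] ^ a) ^ b * [:N b:] ^ a - (1 + [:0, 1:] ^ b) ^ a * [:N a:] ^ b"
  have T: "[:0, 1:] \<in> polys_over K" using K by (simp add: po is_subfield_def)
  have "P0 \<in> polys_over K"
    unfolding P0_def using NK by (intro po T) (simp_all add: po)
  moreover have "poly P0 t = 0"
    by (simp add: P0_def N_def power_mult_distrib mult_ac flip: power_mult)
  moreover have "poly P0 0 \<noteq> 0"
  proof
    assume "poly P0 0 = 0"
    then have "N b ^ a = N a ^ b" using abc by (simp add: P0_def zero_power)
    then have "x ^ (a * b) * (1 + t ^ b) ^ a = x ^ (a * b) * (1 + t ^ a) ^ b"
      by (simp add: N_def power_mult_distrib mult_ac flip: power_mult)
    then have "(1 + t ^ b) ^ a = (1 + t ^ a) ^ b" using xt by simp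
    then show False using fls_one_plus_power_neq[OF abc(2) _ char(1)] abc by (simp add: t_def)
  qed
  then have "P0 \<noteq> 0" by auto
  ultimately obtain m where m: "is_minpoly K t m"
    using minpoly_exists[OF K] by blast
  have mK: "m \<in> polys_over K" "m \<noteq> 0" "poly m t = 0" using m by (simp_all add: is_minpoly_def[OF K])
  have m_dvd: "\<exists>q. P = m * q" if "P \<in> polys_over K" "poly P t = 0" for P
    using m that by (auto simp: is_minpoly_def[OF K])

  \<comment> \<open>\<open>W\<close> is \<open>K(t)\<close>. It contains
    \<open>x ^ k = N k / (1 + t ^ k)\<close> for three coprime exponents, hence \<open>x\<close>,
    which thus becomes a polynomial \<open>Px\<close> in \<open>t\<close> over
    \<open>K\<close>.\<close>
  define W where "W = (\<lambda>P. poly P t) ` polys_over K"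
  have W: "is_subfield W" "K \<subseteq> W" "t \<in> W"
    unfolding W_def using subfield_simple_extension[OF K m] by auto
  have "x ^ k \<in> W" if k: "k \<in> {a, b, c}" for k
  proof -
    have "N k / (1 + t ^ k) \<in> W"
      using NK[OF k] W by (intro subfield_divide) (auto simp: is_subfield_def subfield_power)
    then show ?thesis using one_t[OF pos[OF k]] by (simp add: N_def)
  qed
  then have xW: "x \<in> W" by (rule subfield_coprime_powers[OF W(1) abc(4)]) (simp_all add: xt)
  have in_W: "\<exists>P\<in>polys_over K. poly P t = z" if "z \<in> W" for z using that by (auto simp: W_def)
  obtain Px where Px: "Px \<in> polys_over K" "poly Px t = x" using in_W[OF xW] by blast
  \<comment> \<open>\<open>V\<close> and \<open>U\<close> certify that the conjugates of
    \<open>x\<close> and \<open>t\<close> are nonzero.\<close>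
  have "inverse x \<in> W" "inverse t \<in> W" using xW W by (simp_all add: is_subfield_def)
  then obtain V U where V: "V \<in> polys_over K" "poly V t = inverse x"
    and U: "U \<in> polys_over K" "poly U t = inverse t" using in_W by metis
  define Py where "Py = [:0, 1:] * Px"
  have Py: "Py \<in> polys_over K" "poly Py t = t * x" using Px K by (simp_all add: Py_def po is_subfield_def)
  define H where "H k = Px ^ k + Py ^ k - [:N k:]" for k
  have H: "H k \<in> polys_over K" "poly (H k) t = 0" if "k \<in> {a, b, c}" for k
    unfolding H_def using Px Py NK[OF that]
    by (auto intro!: po(1-4) simp: po N_def power_mult_distrib algebra_simps)

  have separable: "poly (pderiv m) t \<noteq> 0"
  proof
    assume m': "poly (pderiv m) t = 0"
    \<comment> \<open>If \<open>m\<close> had a double root at \<open>t\<close>, differentiating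
      polynomials and evaluating at \<open>t\<close> would be a derivation trivial on
      \<open>K\<close> with \<open>t\<close> mapped to \<open>1\<close>. Then \<rho> is
      \<open>t\<close> times the logarithmic derivative of \<open>x\<close>, and constancy of
      \<open>N a\<close> and \<open>N b\<close> overdetermines it.\<close>
    define \<rho> where "\<rho> = t * poly (pderiv Px) t / x"
    have "(1 + \<rho>) * t ^ k = - \<rho>" if k: "k \<in> {a, b}" for k
    proof -
      have k': "k \<in> {a, b, c}" using k by blast
      obtain q where "H k = m * q" using m_dvd H[OF k'] by blast
      then have "poly (pderiv (H k)) t = 0" using m' mK(3) by (simp add: pderiv_mult)
      moreover have "poly (pderiv (H k)) t = of_nat k * (x ^ (k - 1) * poly (pderiv Px) t +
          (t * x) ^ (k - 1) * (x + t * poly (pderiv Px) t))"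
        using Px(2) Py(2) by (simp add: H_def Py_def pderiv_add pderiv_diff pderiv_power pderiv_mult pderiv_pCons
            algebra_simps)
      moreover have "(of_nat k :: 'a fls) \<noteq> 0"
        using char(1,2) k by (auto simp: fls_of_nat)
      ultimately have "x ^ (k - 1) * poly (pderiv Px) t + (t * x) ^ (k - 1) * (x + t * poly (pderiv Px) t) = 0"
        by (metis mult_eq_0_iff)
      then have "x ^ (k - 1) * (poly (pderiv Px) t + t ^ (k - 1) * (x + t * poly (pderiv Px) t)) = 0"
        by (simp add: power_mult_distrib algebra_simps)
      then have "t * (poly (pderiv Px) t + t ^ (k - 1) * (x + t * poly (pderiv Px) t)) = 0"
        using xt by simp
      moreover have "t ^ k = t * t ^ (k - 1)" using pos[OF k'] by (simp add: power_eq_if)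
      ultimately have "t ^ k * (x + t * poly (pderiv Px) t) + t * poly (pderiv Px) t = 0"
        by (simp only: distrib_left mult.assoc add.commute)
      moreover have "(1 + \<rho>) * t ^ k + \<rho> = (t ^ k * (x + t * poly (pderiv Px) t) + t * poly (pderiv Px) t) / x"
        using xt by (simp add: \<rho>_def field_simps)
      ultimately show ?thesis by (simp add: eq_neg_iff_add_eq_0)
    qed
    then have a: "(1 + \<rho>) * t ^ a = - \<rho>" and "(1 + \<rho>) * t ^ b = - \<rho>" by simp_all
    then have "(1 + \<rho>) * t ^ a = (1 + \<rho>) * t ^ b" by simp
    then have "1 + \<rho> = 0" using t_inj[of a b] abc by simp
    then show False using a by simp
  qed

  define h :: "'a fls \<Rightarrow> 'a fls alg_closure" where "h = to_ac"
  have h: "h (f + g) = h f + h g" "h (f * g) = h f * h g" "h 1 = 1" for f g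
    by (simp_all add: h_def)
  note hom = field_hom_0[OF h] field_hom_diff[OF h] field_hom_power[OF h] field_hom_of_nat[OF h] h
    field_hom_inverse[OF h] field_hom_inj[OF h] field_hom_eq_0_iff[OF h]
  let ?h = "map_poly h"
  have conj: "(s = h t \<or> s = h (inverse t)) \<and> poly (pderiv (?h m)) s \<noteq> 0" if s: "poly (?h m) s = 0" for s
  proof -
    note iff = minpoly_conjugate[OF h K m s]
    have simple: "poly (?h (pderiv m)) s \<noteq> 0"
      using iff[OF polys_over_pderiv[OF K mK(1)]] separable by simp
    have van: "poly (?h P) s = 0" if "P \<in> polys_over K" "poly P t = 0" for P
      using iff[OF that(1)] that(2) by simp
    \<comment> \<open>The images of \<open>x\<close> and \<open>y = t * x\<close> when
      \<open>t\<close> is sent to its conjugate \<open>s\<close>.\<close>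
    define z w where "z = poly (?h Px) s" and "w = poly (?h Py) s"
    have w: "w = s * z"
      by (simp add: w_def z_def Py_def map_poly_hom_mult[OF h] map_poly_pCons hom)
    have "s * poly (?h U) s = 1"
      using van[of "[:0, 1:] * U - 1"] T U xt
      by (simp add: po map_poly_hom_mult[OF h] map_poly_hom_diff[OF h] map_poly_pCons hom)
    then have "s \<noteq> 0" by auto
    have "z * poly (?h V) s = 1"
      using van[of "Px * V - 1"] Px V xt
      by (simp add: po z_def map_poly_hom_mult[OF h] map_poly_hom_diff[OF h] hom)
    then have "z \<noteq> 0" by auto
    then have "w \<noteq> 0" using w \<open>s \<noteq> 0\<close> by simp
    have zw: "z ^ k + w ^ k = h (N k)" if "k \<in> {a, b, c}" for k
      using van[OF H[OF that]]
      by (simp add: H_def z_def w_def map_poly_hom_diff[OF h] map_poly_hom_add[OF h] map_poly_hom_power[OF h]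
          map_poly_pCons hom)
    \<comment> \<open>\<open>D\<close> lifts \<open>d/dt\<close> from the coefficients along
      evaluation at \<open>s\<close>. It kills \<open>m\<close>, hence every \<open>H k\<close>, so
      the Newton equations for \<open>z\<close> and \<open>w\<close> can be differentiated.\<close>
    obtain D where D: "\<And>P Q. D (P + Q) = D P + D Q"
      "\<And>P Q. D (P * Q) = D P * poly (?h Q) s + poly (?h P) s * D Q"
      "\<And>f. D [:f:] = h (fls_deriv f)" "D m = 0"
      using derivation_extends[OF h fls_deriv_add _ simple] by (auto simp: algebra_simps)
    have "D (P ^ Suc k) = of_nat (Suc k) * poly (?h P) s ^ k * D P" for P k
    proof (induction k)
      case (Suc k)
      have "D (P ^ Suc (Suc k)) = D P * poly (?h P) s ^ Suc k + poly (?h P) s * D (P ^ Suc k)"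
        unfolding power_Suc[of P "Suc k"] D(2) map_poly_hom_power[OF h] poly_power ..
      then show ?case unfolding Suc.IH by (simp add: algebra_simps)
    qed simp
    then have D_power: "D (P ^ k) = of_nat k * poly (?h P) s ^ (k - 1) * D P" if "0 < k" for P k
      using that by (cases k) auto
    have dzw: "z ^ (k - 1) * D Px + w ^ (k - 1) * D Py = h (x ^ k * t ^ (k - 1))" if k: "k \<in> {a, b, c}" for k
    proof -
      obtain q where q: "H k = m * q" using m_dvd H[OF k] by blast
      have "D (H k) = 0" using D(2)[of m q] D(4) s by (simp add: q)
      moreover have "Px ^ k + Py ^ k = H k + [:N k:]" by (simp add: H_def)
      ultimately have "D (Px ^ k) + D (Py ^ k) = h (fls_deriv (N k))" using D(1,3) by (metis add_0)
      moreover have "fls_deriv (N k) = of_nat k * (x ^ k * t ^ (k - 1))"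
      proof -
        have "N k = fls_const (x0 ^ k) * (1 + fls_X ^ k)"
          by (simp add: N_def x_def t_def fls_const_power)
        then show ?thesis
          by (simp add: x_def t_def fls_deriv_power fls_const_power mult_ac)
      qed
      ultimately have "of_nat k * (z ^ (k - 1) * D Px + w ^ (k - 1) * D Py) = of_nat k * h (x ^ k * t ^ (k - 1))"
        by (simp add: D_power[OF pos[OF k]] hom z_def w_def algebra_simps)
      moreover have "h (of_nat k) \<noteq> 0"
        using char(1-3) k by (auto simp: field_hom_eq_0_iff[OF h] fls_of_nat)
      ultimately show ?thesis by (simp add: hom)
    qed
    define u v where "u = z / h x" and "v = w / h x"
    have uv: "u \<noteq> 0" "v \<noteq> 0" "h t \<noteq> 0" and hx: "h x \<noteq> 0"
      using \<open>z \<noteq> 0\<close> \<open>w \<noteq> 0\<close> xt by (simp_all add: u_def v_def hom)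
    have sum1: "1 + h t ^ k = u ^ k + v ^ k" if "k \<in> {a, b, c}" for k
    proof -
      have "u ^ k + v ^ k = h (N k) / h x ^ k"
        using zw[OF that] by (simp add: u_def v_def power_divide add_divide_distrib flip: add_divide_distrib)
      then show ?thesis using hx by (simp add: N_def hom)
    qed
    \<comment> \<open>\<open>t\<close> times the logarithmic derivatives of \<open>z\<close> and
      \<open>w\<close>; with them the differentiated equations become linear in \<open>u ^ k\<close>
      and \<open>v ^ k\<close>, with coefficients independent of \<open>k\<close>.\<close>
    define A B where "A = h t * D Px / z" and "B = h t * D Py / w"
    have sum2: "h t ^ k = A * u ^ k + B * v ^ k" if k: "k \<in> {a, b, c}" for k
    proof -
      have pow: "y ^ k = y * y ^ (k - 1)" for y :: "'a fls alg_closure"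
        using pos[OF k] by (simp add: power_eq_if)
      have "A * u ^ k = h t * (z ^ (k - 1) * D Px) / h x ^ k" "B * v ^ k = h t * (w ^ (k - 1) * D Py) / h x ^ k"
        using \<open>z \<noteq> 0\<close> \<open>w \<noteq> 0\<close> by (simp_all add: A_def B_def u_def v_def power_divide pow[of z] pow[of w])
      then have "A * u ^ k + B * v ^ k = h t * h (x ^ k * t ^ (k - 1)) / h x ^ k"
        using dzw[OF k] by (metis add_divide_distrib distrib_left)
      also have "\<dots> = h t ^ k" using hx by (simp add: hom pow[of "h t"])
      finally show ?thesis ..
    qed
    have one: "1 = (1 - A) * u ^ k + (1 - B) * v ^ k" if "k \<in> {a, b, c}" for k
      using sum1[OF that] sum2[OF that] by (simp add: algebra_simps)
    have "tri_root (a - c) (b - c) (h t) u"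
      by (rule trinomial_relation[OF abc(1-3) uv(1,3) one sum2])
    moreover have "tri_root (a - c) (b - c) (h t) v"
      by (rule trinomial_relation[OF abc(1-3) uv(2,3), where A = B and B = A and v = u])
        (use one sum2 in \<open>simp_all add: add.commute\<close>)
    \<comment> \<open>The embedding of power series into the algebraic closure, along which
      \<open>u\<close> and \<open>v\<close> are pulled back to series \<open>f\<close> and
      \<open>g\<close>.\<close>
    moreover define hh where "hh f = h (fps_to_fls f)" for f
    have hh: "hh (f + g) = hh f + hh g" "hh (f * g) = hh f * hh g" "hh 1 = 1" "inj hh" "hh fps_X = h t"
      "hh (f ^ k) = hh f ^ k" for f g k
      by (auto simp: hh_def hom fls_times_fps_to_fls t_def fps_to_fls_power intro: injI)
    moreover have "0 < b - c" "b - c < a - c" "a - c - (b - c) = a - b" using abc by auto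
    ultimately obtain f g where f: "u = hh f" "tri_root (a - c) (b - c) fps_X f"
      and g: "v = hh g" "tri_root (a - c) (b - c) fps_X g"
      using tri_root_in_range[of hh "b - c" "a - c"] char(5,6) by metis
    have "1 + fps_X ^ k = f ^ k + g ^ k" if "k \<in> {a, b, c}" for k
    proof -
      have "hh (1 + fps_X ^ k) = hh (f ^ k + g ^ k)"
        using sum1[OF that] f(1) g(1) by (simp add: hh)
      then show ?thesis using hh(4) by (simp add: inj_eq)
    qed
    then have "f = 1 \<and> g = fps_X \<or> f = fps_X \<and> g = 1"
      by (rule fps_newton_solutions[OF abc char(4-6) f(2) g(2)])
    moreover have "s = hh g / hh f"
      using \<open>z \<noteq> 0\<close> hx by (simp add: w u_def v_def flip: f(1) g(1))
    ultimately have "s = h t \<or> s = h (inverse t)"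
      by (auto simp: hh hom divide_inverse)
    with simple show ?thesis by (simp add: pderiv_map_poly_hom[OF h])
  qed

  define r where "r = inverse t"
  have r: "t * r = 1" using xt by (simp add: r_def)
  have const: "\<exists>e\<in>K. Q = [:e:]" if "Q \<in> polys_over K" "degree Q = 0" for Q
    using that by (metis degree_0_id po(6))
  have root_ex: "\<exists>s. poly (?h Q) s = 0" if "degree Q \<noteq> 0" for Q
    using alg_closed_imp_poly_has_root[of "?h Q"] that by (simp add: degree_map_poly_hom[OF h])
  obtain m1 where m1: "m = [:- t, 1:] * m1"
    using mK(3) by (auto simp: poly_eq_0_iff_dvd elim: dvdE)
  have h_root: "poly (?h [:- y, 1:]) s = s - h y" for y s
    using hom(2)[of 0 y] by (simp add: map_poly_pCons hom)
  have pd: "poly (pderiv (?h (P * Q))) s = poly (?h P) s * poly (pderiv (?h Q)) s + poly (?h Q) s * poly (pderiv (?h P)) s"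
    for P Q s
    by (simp add: map_poly_hom_mult[OF h] pderiv_mult)
  show ?thesis
  proof (cases "degree m1 = 0")
    case True
    then obtain e where e: "m1 = [:e:]" by (metis degree_0_id)
    then have "m = [:- t * e, e:]" by (simp add: m1)
    then have "e \<in> K" "- t * e \<in> K" "e \<noteq> 0" using mK by (auto simp: po)
    then have "(- t * e) / e \<in> K" using K by (intro subfield_divide)
    then have "- t \<in> K" using \<open>e \<noteq> 0\<close> by simp
    then have "- (- t) \<in> K" using K unfolding is_subfield_def by blast
    then have "t \<in> K" by simp
    then show ?thesis using K unfolding is_subfield_def t_def by blast
  next
    case False
    then obtain s where s: "poly (?h m1) s = 0" using root_ex by blast
    then have ms: "poly (?h m) s = 0" by (simp only: m1 map_poly_hom_mult[OF h] poly_mult mult_zero_right)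
    have "s \<noteq> h t"
    proof
      assume "s = h t"
      then have 0: "poly (?h [:- t, 1:]) s = 0" by (simp only: h_root diff_self)
      have "poly (pderiv (?h m)) s = 0"
        by (simp only: m1 pd s 0) simp
      with conj[OF ms] show False by simp
    qed
    then have "s = h r" using conj[OF ms] by (simp add: r_def)
    then have "poly m1 r = 0" using s by (simp add: poly_map_poly_hom[OF h] hom)
    then obtain m2 where m2: "m1 = [:- r, 1:] * m2"
      by (auto simp: poly_eq_0_iff_dvd elim: dvdE)
    have "degree m2 = 0"
    proof (rule ccontr)
      assume "degree m2 \<noteq> 0"
      then obtain s where s: "poly (?h m2) s = 0" using root_ex by blast
      define q where "q = [:- t, 1:] * [:- r, 1:]"
      have m: "m = q * m2" by (simp only: m1 m2 q_def mult.assoc)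
      have "poly (?h m) s = 0" by (simp only: m map_poly_hom_mult[OF h] poly_mult s mult_zero_right)
      from conj[OF this] have *: "s = h t \<or> s = h r" "poly (pderiv (?h m)) s \<noteq> 0" by (simp_all add: r_def)
      have "poly (?h q) s = 0"
        using *(1) by (auto simp only: q_def map_poly_hom_mult[OF h] poly_mult h_root diff_self mult_zero_left mult_zero_right)
      from this s have "poly (pderiv (?h m)) s = 0" by (simp only: m pd mult_zero_left add_0_left)
      with *(2) show False by contradiction
    qed
    then obtain e where e: "m2 = [:e:]" by (metis degree_0_id)
    then have "m = [:e * (t * r), - (e * (t + r)), e:]" by (simp add: m1 m2 algebra_simps)
    then have "e \<in> K" "- (e * (t + r)) \<in> K" "e \<noteq> 0" using mK by (auto simp: po)
    then have "- (e * (t + r)) / e \<in> K" using K by (intro subfield_divide)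
    then have "- (t + r) \<in> K" using \<open>e \<noteq> 0\<close> by (simp add: divide_simps)
    then have "- (- (t + r)) \<in> K" using K unfolding is_subfield_def by blast
    then show ?thesis by (simp add: r_def t_def add.commute)
  qed
qed

section \<open>The field of rational functions\<close>

lemma fract_hom_extends:
  fixes e :: "'a::idom \<Rightarrow> 'b::field"
  assumes e: "\<And>x y. e (x + y) = e x + e y" "\<And>x y. e (x * y) = e x * e y" "e 1 = 1" "\<And>x. e x = 0 \<Longrightarrow> x = 0"
  shows "\<exists>\<phi> :: 'a fract \<Rightarrow> 'b. (\<forall>f g. \<phi> (f + g) = \<phi> f + \<phi> g) \<and> (\<forall>f g. \<phi> (f * g) = \<phi> f * \<phi> g) \<and>
    (\<forall>x. \<phi> (to_fract x) = e x)"
proof -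
  have "\<exists>r. \<forall>a b. b \<noteq> 0 \<longrightarrow> q = Fract a b \<longrightarrow> r = e a / e b" for q
  proof -
    obtain a b where ab: "q = Fract a b" "b \<noteq> 0" by (cases q) auto
    have "e a / e b = e c / e d" if "d \<noteq> 0" "q = Fract c d" for c d
    proof -
      have "a * d = c * b" using that ab by (simp add: eq_fract)
      then have "e a * e d = e c * e b" using e(2) by metis
      moreover have "e b \<noteq> 0" "e d \<noteq> 0" using e(4) that ab by blast+
      ultimately show ?thesis by (simp add: frac_eq_eq)
    qed
    then show ?thesis by blast
  qed
  then obtain \<phi> where "\<And>q a b. b \<noteq> 0 \<Longrightarrow> q = Fract a b \<Longrightarrow> \<phi> q = e a / e b" by metis
  then have \<phi>: "\<phi> (Fract a b) = e a / e b" if "b \<noteq> 0" for a b using that by blast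
  have nz: "e x \<noteq> 0" if "x \<noteq> 0" for x using that e(4) by blast
  have "\<phi> (f + g) = \<phi> f + \<phi> g" for f g
    by (cases f; cases g) (simp add: \<phi> e nz add_frac_eq)
  moreover have "\<phi> (f * g) = \<phi> f * \<phi> g" for f g
    by (cases f; cases g) (simp add: \<phi> e)
  moreover have "\<phi> (to_fract x) = e x" for x
    by (simp add: to_fract_def \<phi> e)
  ultimately show ?thesis by blast
qed

lemma is_subfield_image:
  assumes h: "\<And>x y. h (x + y) = h x + h y" "\<And>x y. h (x * y) = h x * h y" "h 1 = (1 :: 'b::field)"
    and K: "is_subfield (K :: 'a::field set)"
  shows "is_subfield (h ` K)"
proof -
  have "0 \<in> h ` K" "1 \<in> h ` K"
    using K field_hom_0[OF h] h(3) by (auto simp: is_subfield_def intro: image_eqI[of _ _ 0] image_eqI[of _ _ 1])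
  moreover have "h u + h v \<in> h ` K" "h u * h v \<in> h ` K" if "u \<in> K" "v \<in> K" for u v
    using that K by (auto simp: is_subfield_def simp flip: h(1,2))
  moreover have "- h u \<in> h ` K" "inverse (h u) \<in> h ` K" if "u \<in> K" for u
  proof -
    have "- u \<in> K" "inverse u \<in> K" using that K by (auto simp: is_subfield_def)
    moreover have "h (- u) = - h u" using field_hom_diff[OF h, of 0 u] by (simp add: field_hom_0[OF h])
    ultimately show "- h u \<in> h ` K" "inverse (h u) \<in> h ` K"
      using field_hom_inverse[OF h, of u] by (metis imageI)+
  qed
  ultimately show ?thesis by (auto simp: is_subfield_def)
qed

lemma ratfun_const_1: "ratfun_const 1 = 1"
  unfolding ratfun_const_def by (simp flip: one_pCons)

lemma subfield_generators_UNIV: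
  fixes W :: "'k::field ratfun2 set"
  assumes W: "is_subfield W" and "range ratfun_const \<subseteq> W" "ratfun_X \<in> W" "ratfun_Y \<in> W"
  shows "W = UNIV"
proof -
  have cl: "u + v \<in> W" "u * v \<in> W" if "u \<in> W" "v \<in> W" for u v
    using W that by (auto simp: is_subfield_def)
  have 1: "to_fract [:p:] \<in> W" for p
  proof (induction p)
    case 0
    then show ?case using W by (simp add: is_subfield_def)
  next
    case (pCons a p)
    have "to_fract [:pCons a p:] = ratfun_const a + ratfun_X * to_fract [:p:]"
      unfolding ratfun_const_def ratfun_X_def by (simp flip: to_fract_add to_fract_mult)
    then show ?case using pCons.IH assms by (auto intro: cl)
  qed
  have 2: "to_fract P \<in> W" for P
  proof (induction P)
    case 0
    then show ?case using W by (simp add: is_subfield_def)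
  next
    case (pCons a P)
    have "to_fract (pCons a P) = to_fract [:a:] + ratfun_Y * to_fract P"
      unfolding ratfun_Y_def by (simp flip: to_fract_add to_fract_mult)
    then show ?case using pCons.IH 1 assms by (auto intro: cl)
  qed
  have "f \<in> W" for f
  proof -
    obtain P Q where "f = Fract P Q" by (cases f)
    then have "f = to_fract P / to_fract Q" by (simp add: Fract_conv_to_fract)
    then show ?thesis using 2 W subfield_divide by metis
  qed
  then show ?thesis by blast
qed

lemma ratfun_swap_hom:
  fixes f g :: "'k::field ratfun2"
  shows "ratfun_swap (f + g) = ratfun_swap f + ratfun_swap g"
  "ratfun_swap (f * g) = ratfun_swap f * ratfun_swap g"
  "ratfun_swap 1 = (1 :: 'k ratfun2)" "ratfun_swap (ratfun_const c) = (ratfun_const c :: 'k ratfun2)"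
  using ratfun_swap(1) ratfun_const_1 unfolding ratfun_automorphism_def by metis+

lemma is_subfield_symmetric: "is_subfield (symmetric_ratfuns :: 'k::field ratfun2 set)"
  using field_hom_0[of "ratfun_swap :: 'k ratfun2 \<Rightarrow> _"] field_hom_diff[of "ratfun_swap :: 'k ratfun2 \<Rightarrow> _" 0]
    field_hom_inverse[of "ratfun_swap :: 'k ratfun2 \<Rightarrow> _"]
  by (simp add: is_subfield_def symmetric_ratfuns_def ratfun_swap_hom)

lemma newton_poly_symmetric: "newton_poly m \<in> symmetric_ratfuns"
  by (simp add: symmetric_ratfuns_def newton_poly_def ratfun_swap_hom ratfun_swap
      field_hom_power[of ratfun_swap, OF ratfun_swap_hom(1-3)] add.commute)

lemma ratfun_XY_nonzero [simp]: "ratfun_X \<noteq> (0 :: 'k::field ratfun2)" "ratfun_Y \<noteq> (0 :: 'k ratfun2)"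
  by (simp_all add: ratfun_X_def ratfun_Y_def)

lemma ratfun_embedding_exists:
  "\<exists>(\<phi> :: 'k::field ratfun2 \<Rightarrow> 'k poly fract alg_closure fls) x0. (\<forall>f g. \<phi> (f + g) = \<phi> f + \<phi> g) \<and>
    (\<forall>f g. \<phi> (f * g) = \<phi> f * \<phi> g) \<and> \<phi> 1 = 1 \<and> x0 \<noteq> 0 \<and>
    \<phi> ratfun_X = fls_const x0 \<and> \<phi> ratfun_Y = fls_const x0 * fls_X"
proof -
  define q :: "'k poly \<Rightarrow> 'k poly fract alg_closure" where "q p = to_ac (to_fract p)" for p
  have q: "q (f + g) = q f + q g" "q (f * g) = q f * q g" "q 1 = 1" "q 0 = 0" "q f = 0 \<longleftrightarrow> f = 0" for f g
    by (simp_all add: q_def)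
  define x0 where "x0 = q [:0, 1:]"
  have x0: "x0 \<noteq> 0" by (simp add: x0_def q)
  define e :: "'k poly poly \<Rightarrow> 'k poly fract alg_closure fls"
    where "e P = fps_to_fls (fps_of_poly (pcompose (map_poly q P) [:0, x0:]))" for P
  have map_add: "map_poly q (P + Q) = map_poly q P + map_poly q Q" for P Q
    by (rule poly_eqI) (simp add: coeff_map_poly q)
  have map_mult: "map_poly q (P * Q) = map_poly q P * map_poly q Q" for P Q
  proof -
    have "q (sum f I) = (\<Sum>i\<in>I. q (f i))" for f and I :: "nat set"
      by (induction I rule: infinite_finite_induct) (simp_all add: q)
    then show ?thesis by (intro poly_eqI) (simp add: coeff_map_poly coeff_mult q)
  qed
  have "e (P + Q) = e P + e Q" "e (P * Q) = e P * e Q" for P Q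
    by (simp_all add: e_def map_add map_mult pcompose_add pcompose_mult fps_of_poly_add fps_of_poly_mult
        fls_times_fps_to_fls)
  moreover have "e 1 = 1" by (simp add: e_def q pcompose_1)
  moreover have "P = 0" if "e P = 0" for P
  proof -
    have "fps_of_poly (pcompose (map_poly q P) [:0, x0:]) = fps_of_poly 0" using that by (simp add: e_def)
    then have "pcompose (map_poly q P) [:0, x0:] = 0" by (simp only: fps_of_poly_eq_iff)
    then have "map_poly q P = 0" using x0 by (simp add: pcompose_eq_0_iff)
    then show ?thesis by (auto simp: poly_eq_iff coeff_map_poly q)
  qed
  ultimately obtain \<phi> where \<phi>: "\<And>f g. \<phi> (f + g) = \<phi> f + \<phi> g" "\<And>f g. \<phi> (f * g) = \<phi> f * \<phi> g"
    "\<And>P. \<phi> (to_fract P) = e P"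
    using fract_hom_extends[of e] by metis
  moreover have "\<phi> 1 = 1" using \<phi>(3)[of 1] \<open>e 1 = 1\<close> by simp
  moreover have "\<phi> ratfun_X = fls_const x0"
    by (simp add: ratfun_X_def \<phi> e_def map_poly_pCons q x0_def fps_of_poly_const pcompose_pCons)
  moreover have "\<phi> ratfun_Y = fls_const x0 * fls_X"
    by (simp add: ratfun_Y_def \<phi> e_def map_poly_pCons q pcompose_pCons fps_of_poly_pCons fls_times_fps_to_fls)
  ultimately show ?thesis using x0 by blast
qed

theorem proposition4p1:
  fixes p a b c :: nat
  assumes "prime p"
    and "CHAR('k::field) = p"
    and "a > b" and "b > c" and "c > 0"
    and "Gcd {a, b, c} = 1"
    and "\<not> p dvd a" and "\<not> p dvd b" and "\<not> p dvd c"
    and "\<not> p dvd (a - c)" and "\<not> p dvd (a - b)" and "\<not> p dvd (b - c)"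
  shows "generated_field {newton_poly a, newton_poly b, newton_poly c}
           = (symmetric_ratfuns :: 'k ratfun2 set)"
proof
  let ?G = "{newton_poly a, newton_poly b, newton_poly c} :: 'k ratfun2 set"
  show "generated_field ?G \<subseteq> symmetric_ratfuns"
    unfolding generated_field_def
    by (rule hull_minimal) (auto simp: newton_poly_symmetric is_subfield_symmetric, simp add: symmetric_ratfuns_def ratfun_swap_hom)
  define K where "K = generated_field ?G"
  have K: "is_subfield K" unfolding K_def by (rule is_subfield_generated_field)
  have gen: "range ratfun_const \<union> ?G \<subseteq> K" unfolding K_def generated_field_def by (rule hull_subset)
  have NK: "newton_poly k \<in> K" if "k \<in> {a, b, c}" for k using gen that by auto

  obtain \<phi> :: "'k ratfun2 \<Rightarrow> 'k poly fract alg_closure fls" and x0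
    where \<phi>: "\<And>f g. \<phi> (f + g) = \<phi> f + \<phi> g" "\<And>f g. \<phi> (f * g) = \<phi> f * \<phi> g" "\<phi> 1 = 1"
      and x0: "x0 \<noteq> 0" "\<phi> ratfun_X = fls_const x0" "\<phi> ratfun_Y = fls_const x0 * fls_X"
    using ratfun_embedding_exists by metis
  define t :: "'k ratfun2" where "t = ratfun_Y / ratfun_X"
  have Y: "ratfun_Y = ratfun_X * t" by (simp add: t_def)
  have \<phi>_t: "\<phi> t = fls_X"
    using x0 by (simp add: t_def divide_inverse \<phi> field_hom_inverse[OF \<phi>])
  have char: "of_nat k \<noteq> (0 :: 'k poly fract alg_closure)" if "\<not> p dvd k" for k
  proof -
    have "(of_nat k :: 'k) \<noteq> 0" using that assms(2) by (simp add: of_nat_eq_0_iff_char_dvd)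
    moreover have "(of_nat k :: 'k poly fract) = to_fract (of_nat k)"
      by (induction k) simp_all
    ultimately have "(of_nat k :: 'k poly fract) \<noteq> 0" by (simp add: of_nat_poly)
    then show ?thesis by (metis to_ac_eq_0_iff to_ac_of_nat)
  qed
  have "fls_X + inverse fls_X \<in> \<phi> ` K"
  proof (rule fls_symmetric_in_subfield[OF assms(4,3,5,6)
        assms(7,8,9,10,12,11)[THEN char] x0(1)])
    show "is_subfield (\<phi> ` K)" by (rule is_subfield_image[OF \<phi> K])
    show "fls_const x0 ^ k * (1 + fls_X ^ k) \<in> \<phi> ` K" if "k \<in> {a, b, c}" for k
    proof -
      have "\<phi> (newton_poly k) = fls_const x0 ^ k * (1 + fls_X ^ k)"
        by (simp add: newton_poly_def \<phi> field_hom_power[OF \<phi>] x0 power_mult_distrib distrib_left)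
      then show ?thesis using NK[OF that] by (metis imageI)
    qed
  qed
  then have "\<phi> (t + inverse t) \<in> \<phi> ` K"
    by (simp add: \<phi> \<phi>_t field_hom_inverse[OF \<phi>])
  then have e: "t + inverse t \<in> K"
    using field_hom_inj[OF \<phi>] by (auto simp: inj_image_mem_iff)

  have K_sub: "K \<subseteq> symmetric_ratfuns"
    using \<open>generated_field ?G \<subseteq> symmetric_ratfuns\<close> by (simp add: K_def)
  then have fixed: "ratfun_swap u = u" if "u \<in> K" for u
    using that by (auto simp: symmetric_ratfuns_def)
  note swap_hom = ratfun_swap_hom[where ?'k = 'k]
  have swap_t: "ratfun_swap t = inverse t"
    by (simp add: t_def divide_inverse ratfun_swap_hom ratfun_swap field_hom_inverse[of ratfun_swap, OF swap_hom(1-3)])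
  have t: "t \<noteq> 0" by (simp add: t_def)
  define s where "s = t + inverse t"
  have s: "s \<in> K" "t * t = s * t - 1" "inverse t = s - t" using e t by (simp_all add: s_def algebra_simps)
  have K01: "0 \<in> K" "1 \<in> K" and K_inverse: "\<And>u. u \<in> K \<Longrightarrow> - u \<in> K \<and> inverse u \<in> K"
    and K_ring: "\<And>u v. u \<in> K \<Longrightarrow> v \<in> K \<Longrightarrow> u + v \<in> K \<and> u * v \<in> K \<and> u - v \<in> K"
    using K by (auto simp: is_subfield_def subfield_minus)
  note cl = K01 K_inverse K_ring
  define W where "W = {u + v * t |u v. u \<in> K \<and> v \<in> K}"
  have W_I: "z \<in> W" if "z = u + v * t" "u \<in> K" "v \<in> K" for z u v using that by (auto simp: W_def)
  have K_W: "K \<subseteq> W" using W_I[of _ _ 0] K01 by fastforce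
  have W_add: "z + z' \<in> W" and W_mult: "z * z' \<in> W" if "z \<in> W" "z' \<in> W" for z z'
  proof -
    obtain u v u' v' where z: "z = u + v * t" "z' = u' + v' * t" and uv: "u \<in> K" "v \<in> K" "u' \<in> K" "v' \<in> K"
      using \<open>z \<in> W\<close> \<open>z' \<in> W\<close> by (auto simp: W_def)
    have "z + z' = (u + u') + (v + v') * t" by (simp add: z algebra_simps)
    then show "z + z' \<in> W" by (rule W_I) (use uv cl in auto)
    have "z * z' = u * u' + (u * v' + v * u') * t + v * v' * (t * t)" by (simp add: z algebra_simps)
    also have "\<dots> = (u * u' + - (v * v')) + (u * v' + v * u' + v * v' * s) * t"
      unfolding s(2) by (simp add: algebra_simps)
    finally show "z * z' \<in> W" by (rule W_I) (use uv s(1) cl in auto)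
  qed
  have W_inv: "inverse z \<in> W" if "z \<in> W" for z
  proof (cases "z = 0")
    case False
    obtain u v where z: "z = u + v * t" and uv: "u \<in> K" "v \<in> K" using \<open>z \<in> W\<close> by (auto simp: W_def)
    define z' where "z' = ratfun_swap z"
    have z': "z' = (u + v * s) + (- v) * t"
      using uv by (simp add: z'_def z swap_hom fixed swap_t s(3) algebra_simps)
    have "z' \<noteq> 0" using False field_hom_eq_0_iff[of ratfun_swap, OF swap_hom(1-3)] by (simp add: z'_def)
    have "z * z' = u * u + u * v * s + v * v * (s * t - t * t)"
      by (simp add: z z' algebra_simps)
    also have "\<dots> = u * u + u * v * s + v * v" by (simp add: s(2))
    finally have "z * z' \<in> K" using uv s(1) cl by auto
    then have "inverse (z * z') \<in> W" using cl K_W by blast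
    moreover have "z' \<in> W" using z' by (rule W_I) (use uv s(1) cl in auto)
    moreover have "inverse z = z' * inverse (z * z')" using False \<open>z' \<noteq> 0\<close> by simp
    ultimately show ?thesis using W_mult by metis
  qed (use K_W cl in auto)
  have W_neg: "- z \<in> W" if "z \<in> W" for z
    using W_mult[of "- 1" z] that K_W cl by auto
  have W: "is_subfield W"
    using W_add W_mult W_inv W_neg K_W cl by (auto simp: is_subfield_def)
  have t_W: "t \<in> W" by (rule W_I[of _ 0 1]) (use cl in auto)
  have "ratfun_X ^ k \<in> W" if k: "k \<in> {a, b, c}" for k
  proof -
    have "0 < k" using k assms by auto
    then have "\<phi> (1 + t ^ k) \<noteq> 0"
      using fls_one_plus_X_power_nonzero by (simp add: \<phi> field_hom_power[OF \<phi>] \<phi>_t)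
    then have "1 + t ^ k \<noteq> 0" by (metis field_hom_0[OF \<phi>])
    moreover have "newton_poly k = ratfun_X ^ k * (1 + t ^ k)"
      by (simp add: newton_poly_def Y power_mult_distrib algebra_simps)
    ultimately have "ratfun_X ^ k = newton_poly k / (1 + t ^ k)" by simp
    moreover have "1 + t ^ k \<in> W" using W t_W by (simp add: is_subfield_def subfield_power)
    ultimately show ?thesis using NK[OF k] K_W W by (auto intro: subfield_divide)
  qed
  then have X_W: "ratfun_X \<in> W"
    by (rule subfield_coprime_powers[OF W assms(6)]) simp_all
  have "W = UNIV"
    using gen K_W X_W W_mult[OF X_W t_W] by (intro subfield_generators_UNIV W) (auto simp: Y)
  show "symmetric_ratfuns \<subseteq> generated_field ?G"
  proof
    fix f :: "'k ratfun2" assume f: "f \<in> symmetric_ratfuns"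
    have "f \<in> W" using \<open>W = UNIV\<close> by simp
    then obtain u v where uv: "f = u + v * t" "u \<in> K" "v \<in> K" by (auto simp: W_def)
    have "ratfun_swap f = u + v * inverse t"
      by (simp add: uv swap_hom fixed swap_t)
    then have "u + v * t = u + v * inverse t"
      using f uv(1) by (simp only: symmetric_ratfuns_def mem_Collect_eq)
    then have "v * (t - inverse t) = 0" by (simp only: add_left_cancel right_diff_distrib diff_self)
    moreover have "t - inverse t \<noteq> 0"
    proof
      assume "t - inverse t = 0"
      then have "t ^ 2 = t ^ 0" using t by (simp add: power2_eq_square field_simps)
      then have "\<phi> t ^ 2 = \<phi> t ^ 0" by (metis field_hom_power[OF \<phi>])
      then show False by (simp add: \<phi>_t fls_X_power_inj del: power_0)
    qed
    ultimately show "f \<in> generated_field ?G" using uv by (simp add: K_def)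
  qed
qed

end
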